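(* Let $1\le p\le2$. For $m\in\mathbb{N}$ and $\varepsilon\in(0,1)$, the randomized algorithm $A_p^{\varepsilon}:=A_p^{\bar\varepsilon,\bar\delta}$ with $\bar\varepsilon=\bar\delta:=\varepsilon/2$ (where $A_p^{\bar\varepsilon,\bar\delta}$ is defined in the context) satisfies $$\sup_{\boldsymbol{x}\in\mathbb{R}^m,\ \|\boldsymbol{x}\|_p\le 1}\mathbb{E}\,\|A_p^{\varepsilon}(\boldsymbol{x})-\boldsymbol{x}\|_\infty\le\varepsilon .$$ Moreover, there exists a constant $C_p>0$, depending only on $p$, such that for all $m\ge16$ and all $0<\varepsilon<\tfrac12$, $$\mathrm{card}(A_p^{\varepsilon})\ \le\ C_p\left(\log\varepsilon^{-1}+\log\log m\right)\varepsilon^{-p}.$$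
   Context: Notation: $[m]=\{1,\ldots,m\}$; $\mathrm{unif}$ denotes the uniform distribution; $\log$ is the natural logarithm; $\|\boldsymbol{x}\|_p=(\sum_i|x_i|^p)^{1/p}$, $\|\boldsymbol{x}\|_\infty=\max_i|x_i|$. $\mathrm{card}(A)$ is the maximal number of linear functionals of the input $\boldsymbol{x}$ that the algorithm $A$ evaluates. Subroutine BucketSelect. Given $\boldsymbol{h}\in[D]^m$ with buckets $J_d=\{i\in[m]:h_i=d\}$, $d\in[D]$, and $R,G,k\in\mathbb{N}$, $R$ odd, $k\le D$: draw independent hash vectors $\boldsymbol{H}^{(1)},\ldots,\boldsymbol{H}^{(R)}\sim\mathrm{unif}([G]^D)$ and independent signs $\sigma_{ri}\sim\mathrm{unif}\{\pm1\}$ ($r\in[R]$, $i\in[m]$), all independent. Measure $Y_{r,g}=\sum_{d\in[D]:H_d^{(r)}=g}\sum_{i\in J_d}\sigma_{ri}x_i$ for $r\in[R]$, $g\in[G]$ ($RG$ measurements), and put $\hat Y_{r,d}=Y_{r,H_d^{(r)}}$ and $Z_d=\mathrm{med}\{|\hat Y_{r,d}|:r\in[R]\}$. Output a set $I_k\subseteq[D]$ with $\#I_k=k$ and $\min\{Z_d:d\in I_k\}\ge\max\{Z_d:d\in[D]\setminus I_k\}$. Subroutine Shrink. Given $S_0\subseteq[m]$ and a hash vector $\boldsymbol{h}$ with values in $[D_0]$: with pairwise independent $\sigma_i\sim\mathrm{unif}\{\pm1\}$, measure $Y_1=\sum_{i\in S_0}\sigma_ix_i$ and $Y_2=\sum_{i\in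 S_0}(h_i-\frac{D_0+1}{2})\sigma_ix_i$, and output $\mathrm{Shrink}_{\boldsymbol{h}}(\boldsymbol{x},S_0)=\{i\in S_0:h_i=\lceil Y_2/Y_1+D_0/2\rceil\}$, with the empty set as output if $Y_1=0$. Subroutine Spot. Given $\alpha\in(0,1)$ and $J\subseteq[m]$: let $k^\ast=\max\{0,\lceil\log_{9/8}\frac{\log_2 m}{8}\rceil\}$ ($k^\ast=0$ for $m=1$) and $D_k=\lceil 2^{8(9/8)^k+k+2}\alpha^{-1}\rceil$. For $k=0,\ldots,k^\ast-1$ let $\boldsymbol{H}^{(k)}=(H^{(k)}_i)_{i\in J}$ be independent hash vectors, each with pairwise independent entries $H_i^{(k)}\sim\mathrm{unif}[D_k]$, independent of the signs used in Shrink. Put $S_0=J$ and, as long as $\#S_k>1$ and $k<k^\ast$, $S_{k+1}=\mathrm{Shrink}_{\boldsymbol{H}^{(k)}}(\boldsymbol{x},S_k)$; if a set $S_k$ with $\#S_k\le1$ occurs, it is the output. If still $\#S_{k^\ast}>1$, output $\mathrm{Shrink}_{\boldsymbol{h}^\ast}(\boldsymbol{x},S_{k^\ast})$, where $\boldsymbol{h}^\ast$ is injective on $S_{k^\ast}$ with values in $[\#S_{k^\ast}]$ (so $D_0=\#S_{k^\ast}$ there). The output is denoted $\mathrm{Spot}_\alpha(\boldsymbol{x},J)$. (The same signs may be used for all shrinking steps.) The algorithm $A_p^{\varepsilon,\delta}$ for $\varepsilon,\delta\in(0,1)$. Parameters: $k_0=\lfloor\varepsilon^{-p}\rfloor$,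 $\delta_0=\delta_1=\delta/4$, $\alpha=\delta/(2k_0)$, $\gamma=2049\sqrt2\,\alpha^{-3/2}$, $D=\lceil(\gamma/\varepsilon)^pk_0/\delta_0\rceil$, $R=2\lceil\log_2\frac{D}{2\delta_1}-\frac12\rceil+1$, $k=\lfloor2^{7p/2}\varepsilon^{-p}\rfloor$, $G=4k$. 1. Draw a hash vector $\boldsymbol{H}=(H_i)_{i=1}^m$ with pairwise independent $H_i\sim\mathrm{unif}[D]$, let $J_d=\{i\in[m]:H_i=d\}$, and compute $I_k\subseteq[D]$ by BucketSelect with parameters $R,G,k$ and hash vector $\boldsymbol{H}$. 2. Compute $K=\bigcup_{d\in I_k}\mathrm{Spot}_\alpha(\boldsymbol{x},J_d)$. 3. Observe $x_i$ for $i\in K$ and output $\boldsymbol{z}$ with $z_i=x_i$ for $i\in K$ and $z_i=0$ otherwise; this is $A_p^{\varepsilon,\delta}(\boldsymbol{x})$. The random parameters of the subroutines are independent of $\boldsymbol{H}$, and the random parameters of BucketSelect are independent of those of Spot. *)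

theory Defs
  imports "HOL-Probability.Probability"
begin

text \<open>A vector of \<open>\<real>\<^sup>m\<close> is a function \<open>nat \<Rightarrow> real\<close> of which only the entries with index in
  \<open>{1..m}\<close> matter.\<close>

definition lp_norm :: "real \<Rightarrow> nat \<Rightarrow> (nat \<Rightarrow> real) \<Rightarrow> real" where
  "lp_norm p m x = (\<Sum>i\<in>{1..m}. \<bar>x i\<bar> powr p) powr (1 / p)"

definition linf_norm :: "nat \<Rightarrow> (nat \<Rightarrow> real) \<Rightarrow> real" where
  "linf_norm m x = Max ((\<lambda>i. \<bar>x i\<bar>) ` {1..m})"

text \<open>\<open>Measure a f\<close> evaluates the linear functional \<open>x \<mapsto> \<Sum>\<^sub>i a\<^sub>i x\<^sub>i\<close> at the input and continues with
  \<open>f\<close> applied to the value. Evaluating functionals is the only access to the input.\<close>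

datatype 'a alg = Return 'a | Measure "nat \<Rightarrow> real" "real \<Rightarrow> 'a alg"

primrec bind_alg :: "'a alg \<Rightarrow> ('a \<Rightarrow> 'b alg) \<Rightarrow> 'b alg" where
  "bind_alg (Return v) c = c v"
| "bind_alg (Measure a f) c = Measure a (\<lambda>y. bind_alg (f y) c)"

primrec run :: "nat \<Rightarrow> (nat \<Rightarrow> real) \<Rightarrow> 'a alg \<Rightarrow> 'a" where
  "run m x (Return v) = v"
| "run m x (Measure a f) = run m x (f (\<Sum>i\<in>{1..m}. a i * x i))"

primrec num_meas :: "nat \<Rightarrow> (nat \<Rightarrow> real) \<Rightarrow> 'a alg \<Rightarrow> nat" where
  "num_meas m x (Return v) = 0"
| "num_meas m x (Measure a f) = Suc (num_meas m x (f (\<Sum>i\<in>{1..m}. a i * x i)))"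

text \<open>Nonadaptive evaluation of the functionals \<open>a j\<close>, for \<open>j\<close> in the list; the resulting function
  is \<open>0\<close> at all other arguments.\<close>

primrec measure_family :: "'j list \<Rightarrow> ('j \<Rightarrow> nat \<Rightarrow> real) \<Rightarrow> ('j \<Rightarrow> real) alg" where
  "measure_family [] a = Return (\<lambda>_. 0)"
| "measure_family (j # js) a =
     Measure (a j) (\<lambda>y. bind_alg (measure_family js a) (\<lambda>Y. Return (Y(j := y))))"

primrec union_alg :: "'j list \<Rightarrow> ('j \<Rightarrow> 'a set alg) \<Rightarrow> 'a set alg" where
  "union_alg [] A = Return {}"
| "union_alg (j # js) A =
     bind_alg (A j) (\<lambda>S. bind_alg (union_alg js A) (\<lambda>T. Return (S \<union> T)))"

text \<open>A randomized algorithm is a probability distribution on deterministic algorithms. All random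
  parameters below are finitely many random variables with finitely many values, so discrete
  distributions suffice.\<close>

type_synonym rand_alg = "(nat \<Rightarrow> real) alg pmf"

definition expected_error :: "nat \<Rightarrow> rand_alg \<Rightarrow> (nat \<Rightarrow> real) \<Rightarrow> ennreal" where
  "expected_error m A x = (\<integral>\<^sup>+a. ennreal (linf_norm m (\<lambda>i. run m x a i - x i)) \<partial>measure_pmf A)"

definition card_alg :: "nat \<Rightarrow> rand_alg \<Rightarrow> enat" where
  "card_alg m A = (SUP a\<in>set_pmf A. SUP x. enat (num_meas m x a))"

definition bucket :: "nat \<Rightarrow> (nat \<Rightarrow> nat) \<Rightarrow> nat \<Rightarrow> nat set" where
  "bucket m h d = {i\<in>{1..m}. h i = d}"

text \<open>The median; meant for lists of odd length.\<close>

definition median :: "real list \<Rightarrow> real" where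
  "median ys = sort ys ! (length ys div 2)"

text \<open>The rule that turns \<open>(Z\<^sub>d)\<^sub>d\<close> into \<open>I\<^sub>k\<close> is arbitrary where there are ties.\<close>

definition selection_rule :: "nat \<Rightarrow> nat \<Rightarrow> ((nat \<Rightarrow> real) \<Rightarrow> nat set) \<Rightarrow> bool" where
  "selection_rule D k sel \<longleftrightarrow>
     (\<forall>Z. sel Z \<subseteq> {1..D} \<and> card (sel Z) = k \<and>
          (\<forall>d\<in>sel Z. \<forall>d'\<in>{1..D} - sel Z. Z d' \<le> Z d))"

definition bucket_select ::
  "nat \<Rightarrow> nat \<Rightarrow> nat \<Rightarrow> nat \<Rightarrow> ((nat \<Rightarrow> real) \<Rightarrow> nat set) \<Rightarrow>
   (nat \<Rightarrow> nat) \<Rightarrow> (nat \<Rightarrow> nat \<Rightarrow> nat) \<Rightarrow> (nat \<Rightarrow> nat \<Rightarrow> real) \<Rightarrow> nat set alg" where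
  "bucket_select m D R G sel h H \<sigma> =
     bind_alg
       (measure_family (List.product [1..<Suc R] [1..<Suc G])
         (\<lambda>(r, g) i. \<Sum>d\<in>{d\<in>{1..D}. H r d = g}. if i \<in> bucket m h d then \<sigma> r i else 0))
       (\<lambda>Y. Return (sel (\<lambda>d\<in>{1..D}. median (map (\<lambda>r. \<bar>Y (r, H r d)\<bar>) [1..<Suc R]))))"

definition shrink :: "nat \<Rightarrow> (nat \<Rightarrow> nat) \<Rightarrow> (nat \<Rightarrow> real) \<Rightarrow> nat set \<Rightarrow> nat set alg" where
  "shrink D0 h \<sigma> S =
     Measure (\<lambda>i. if i \<in> S then \<sigma> i else 0) (\<lambda>Y1.
     Measure (\<lambda>i. if i \<in> S then (real (h i) - (real D0 + 1) / 2) * \<sigma> i else 0) (\<lambda>Y2.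
     Return (if Y1 = 0 then {} else {i\<in>S. int (h i) = \<lceil>Y2 / Y1 + real D0 / 2\<rceil>})))"

definition spot_kstar :: "nat \<Rightarrow> nat" where
  "spot_kstar m = (if m = 1 then 0 else nat (max 0 \<lceil>log (9/8) (log 2 (real m) / 8)\<rceil>))"

definition spot_D :: "real \<Rightarrow> nat \<Rightarrow> nat" where
  "spot_D \<alpha> k = nat \<lceil>2 powr (8 * (9/8) ^ k + real k + 2) / \<alpha>\<rceil>"

text \<open>\<open>e S\<close> is the injective hash vector used in the final shrinking step on the set \<open>S\<close>.\<close>

definition enumeration_rule :: "nat \<Rightarrow> (nat set \<Rightarrow> nat \<Rightarrow> nat) \<Rightarrow> bool" where
  "enumeration_rule m e \<longleftrightarrow>
     (\<forall>S\<subseteq>{1..m}. inj_on (e S) S \<and> e S ` S \<subseteq> {1..card S})"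

text \<open>\<open>spot_from ks \<alpha> e H \<sigma> k S\<close> is the remaining computation when \<open>S\<^sub>k = S\<close> has been reached, where
  \<open>ks\<close> is the number of hashing steps and \<open>\<sigma> k\<close> are the signs used in step \<open>k\<close>.\<close>

function spot_from ::
  "nat \<Rightarrow> real \<Rightarrow> (nat set \<Rightarrow> nat \<Rightarrow> nat) \<Rightarrow> (nat \<Rightarrow> nat \<Rightarrow> nat) \<Rightarrow> (nat \<Rightarrow> nat \<Rightarrow> real) \<Rightarrow>
   nat \<Rightarrow> nat set \<Rightarrow> nat set alg" where
  "spot_from ks \<alpha> e H \<sigma> k S =
     (if card S \<le> 1 then Return S
      else if k < ks then
        bind_alg (shrink (spot_D \<alpha> k) (H k) (\<sigma> k) S) (\<lambda>S'. spot_from ks \<alpha> e H \<sigma> (Suc k) S')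
      else shrink (card S) (e S) (\<sigma> k) S)"
  by pat_completeness auto
termination
  by (relation "Wellfounded.measure (\<lambda>(ks, \<alpha>, e, H, \<sigma>, k, S). ks - k)") auto

declare spot_from.simps [simp del]

definition spot ::
  "nat \<Rightarrow> real \<Rightarrow> (nat set \<Rightarrow> nat \<Rightarrow> nat) \<Rightarrow> (nat \<Rightarrow> nat \<Rightarrow> nat) \<Rightarrow> (nat \<Rightarrow> nat \<Rightarrow> real) \<Rightarrow>
   nat set \<Rightarrow> nat set alg" where
  "spot m \<alpha> e H \<sigma> J = spot_from (spot_kstar m) \<alpha> e H \<sigma> 0 J"

definition A_k0 :: "real \<Rightarrow> real \<Rightarrow> nat" where
  "A_k0 p \<epsilon> = nat \<lfloor>\<epsilon> powr (-p)\<rfloor>"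

definition A_alpha :: "real \<Rightarrow> real \<Rightarrow> real \<Rightarrow> real" where
  "A_alpha p \<epsilon> \<delta> = \<delta> / (2 * real (A_k0 p \<epsilon>))"

definition A_gamma :: "real \<Rightarrow> real \<Rightarrow> real \<Rightarrow> real" where
  "A_gamma p \<epsilon> \<delta> = 2049 * sqrt 2 * A_alpha p \<epsilon> \<delta> powr (-3/2)"

definition A_D :: "real \<Rightarrow> real \<Rightarrow> real \<Rightarrow> nat" where
  "A_D p \<epsilon> \<delta> = nat \<lceil>(A_gamma p \<epsilon> \<delta> / \<epsilon>) powr p * real (A_k0 p \<epsilon>) / (\<delta> / 4)\<rceil>"

definition A_R :: "real \<Rightarrow> real \<Rightarrow> real \<Rightarrow> nat" where
  "A_R p \<epsilon> \<delta> = nat (2 * \<lceil>log 2 (real (A_D p \<epsilon> \<delta>) / (2 * (\<delta> / 4))) - 1/2\<rceil> + 1)"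

definition A_k :: "real \<Rightarrow> real \<Rightarrow> nat" where
  "A_k p \<epsilon> = nat \<lfloor>2 powr (7 * p / 2) * \<epsilon> powr (-p)\<rfloor>"

definition A_G :: "real \<Rightarrow> real \<Rightarrow> nat" where
  "A_G p \<epsilon> = 4 * A_k p \<epsilon>"

text \<open>The random parameters. Arguments: \<open>bucket_hash\<close> takes \<open>i \<in> [m]\<close>; \<open>sel_hash\<close> takes \<open>r \<in> [R]\<close> and
  \<open>d \<in> [D]\<close>; \<open>sel_sign\<close> takes \<open>r \<in> [R]\<close> and \<open>i \<in> [m]\<close>; \<open>spot_hash\<close> and \<open>spot_sign\<close> take a bucket
  \<open>d \<in> [D]\<close>, the shrinking step \<open>k\<close> and \<open>i \<in> [m]\<close> (of which Spot uses the \<open>i \<in> J\<^sub>d\<close>).\<close>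

record seed =
  bucket_hash :: "nat \<Rightarrow> nat"
  sel_hash :: "nat \<Rightarrow> nat \<Rightarrow> nat"
  sel_sign :: "nat \<Rightarrow> nat \<Rightarrow> real"
  spot_hash :: "nat \<Rightarrow> nat \<Rightarrow> nat \<Rightarrow> nat"
  spot_sign :: "nat \<Rightarrow> nat \<Rightarrow> nat \<Rightarrow> real"

definition det_alg ::
  "real \<Rightarrow> real \<Rightarrow> real \<Rightarrow> nat \<Rightarrow> ((nat \<Rightarrow> real) \<Rightarrow> nat set) \<Rightarrow> (nat set \<Rightarrow> nat \<Rightarrow> nat) \<Rightarrow>
   seed \<Rightarrow> (nat \<Rightarrow> real) alg" where
  "det_alg p \<epsilon> \<delta> m sel e s =
     bind_alg
       (bucket_select m (A_D p \<epsilon> \<delta>) (A_R p \<epsilon> \<delta>) (A_G p \<epsilon>) sel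
          (bucket_hash s) (sel_hash s) (sel_sign s)) (\<lambda>I.
     bind_alg
       (union_alg (sorted_list_of_set I)
          (\<lambda>d. spot m (A_alpha p \<epsilon> \<delta>) e (spot_hash s d) (spot_sign s d)
                 (bucket m (bucket_hash s) d))) (\<lambda>K.
     measure_family (sorted_list_of_set K) (\<lambda>j i. if i = j then 1 else 0)))"

text \<open>Independence of the \<open>\<sigma>\<close>-algebras generated by two discrete random variables, whose types of
  values may differ (unlike in \<open>prob_space.indep_var\<close>).\<close>

definition indep_rv :: "'s pmf \<Rightarrow> ('s \<Rightarrow> 'a) \<Rightarrow> ('s \<Rightarrow> 'b) \<Rightarrow> bool" where
  "indep_rv P X Y \<longleftrightarrow>
     prob_space.indep_set (measure_pmf P) (range (vimage X)) (range (vimage Y))"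

definition pairwise_indep_unif :: "'s pmf \<Rightarrow> 'i set \<Rightarrow> 'a set \<Rightarrow> ('i \<Rightarrow> 's \<Rightarrow> 'a) \<Rightarrow> bool" where
  "pairwise_indep_unif P I V X \<longleftrightarrow>
     (\<forall>i\<in>I. map_pmf (X i) P = pmf_of_set V) \<and>
     (\<forall>i\<in>I. \<forall>j\<in>I. i \<noteq> j \<longrightarrow> indep_rv P (X i) (X j))"

definition indep_unif :: "'s pmf \<Rightarrow> 'i set \<Rightarrow> 'a set \<Rightarrow> ('i \<Rightarrow> 's \<Rightarrow> 'a) \<Rightarrow> bool" where
  "indep_unif P I V X \<longleftrightarrow>
     (\<forall>i\<in>I. map_pmf (X i) P = pmf_of_set V) \<and>
     prob_space.indep_vars (measure_pmf P) (\<lambda>_. count_space UNIV) X I"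

definition sel_hashes :: "nat \<Rightarrow> nat \<Rightarrow> seed \<Rightarrow> nat \<Rightarrow> nat \<Rightarrow> nat" where
  "sel_hashes D R s = (\<lambda>r\<in>{1..R}. \<lambda>d\<in>{1..D}. sel_hash s r d)"

definition sel_signs :: "nat \<Rightarrow> nat \<Rightarrow> seed \<Rightarrow> nat \<Rightarrow> nat \<Rightarrow> real" where
  "sel_signs m R s = (\<lambda>r\<in>{1..R}. \<lambda>i\<in>{1..m}. sel_sign s r i)"

definition bucket_select_law :: "nat \<Rightarrow> nat \<Rightarrow> nat \<Rightarrow> nat \<Rightarrow> seed pmf \<Rightarrow> bool" where
  "bucket_select_law m D R G P \<longleftrightarrow>
     indep_unif P {1..R} ({1..D} \<rightarrow>\<^sub>E {1..G}) (\<lambda>r s. \<lambda>d\<in>{1..D}. sel_hash s r d) \<and>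
     indep_unif P ({1..R} \<times> {1..m}) {-1, 1} (\<lambda>(r, i) s. sel_sign s r i) \<and>
     indep_rv P (sel_hashes D R) (sel_signs m R)"

definition spot_hashes :: "nat \<Rightarrow> nat \<Rightarrow> seed \<Rightarrow> nat \<Rightarrow> nat \<Rightarrow> nat" where
  "spot_hashes m d s = (\<lambda>k\<in>{..<spot_kstar m}. \<lambda>i\<in>{1..m}. spot_hash s d k i)"

definition spot_signs :: "nat \<Rightarrow> nat \<Rightarrow> seed \<Rightarrow> nat \<Rightarrow> nat \<Rightarrow> real" where
  "spot_signs m d s = (\<lambda>k\<in>{..spot_kstar m}. \<lambda>i\<in>{1..m}. spot_sign s d k i)"

text \<open>The law of the random parameters of Spot for the bucket \<open>d\<close>. The joint law of the sign vectors
  of different steps is arbitrary; in particular they may coincide.\<close>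

definition spot_law :: "nat \<Rightarrow> real \<Rightarrow> nat \<Rightarrow> seed pmf \<Rightarrow> bool" where
  "spot_law m \<alpha> d P \<longleftrightarrow>
     (\<forall>k<spot_kstar m.
        pairwise_indep_unif P {1..m} {1..spot_D \<alpha> k} (\<lambda>i s. spot_hash s d k i)) \<and>
     prob_space.indep_vars (measure_pmf P) (\<lambda>_. count_space UNIV)
       (\<lambda>k s. \<lambda>i\<in>{1..m}. spot_hash s d k i) {..<spot_kstar m} \<and>
     (\<forall>k\<le>spot_kstar m. pairwise_indep_unif P {1..m} {-1, 1} (\<lambda>i s. spot_sign s d k i)) \<and>
     indep_rv P (spot_hashes m d) (spot_signs m d)"

text \<open>Nothing is required of the joint law of the parameters
  of Spot for different buckets.\<close>

definition seed_law :: "real \<Rightarrow> real \<Rightarrow> real \<Rightarrow> nat \<Rightarrow> seed pmf \<Rightarrow> bool" where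
  "seed_law p \<epsilon> \<delta> m P \<longleftrightarrow>
     (let D = A_D p \<epsilon> \<delta>; R = A_R p \<epsilon> \<delta>;
          bucket_par = (\<lambda>s. \<lambda>i\<in>{1..m}. bucket_hash s i);
          sel_par = (\<lambda>s. (sel_hashes D R s, sel_signs m R s));
          spot_par = (\<lambda>s. \<lambda>d\<in>{1..D}. (spot_hashes m d s, spot_signs m d s))
      in pairwise_indep_unif P {1..m} {1..D} (\<lambda>i s. bucket_hash s i) \<and>
         bucket_select_law m D R (A_G p \<epsilon>) P \<and>
         (\<forall>d\<in>{1..D}. spot_law m (A_alpha p \<epsilon> \<delta>) d P) \<and>
         indep_rv P bucket_par (\<lambda>s. (sel_par s, spot_par s)) \<and>
         indep_rv P sel_par spot_par)"

text \<open>The description of the algorithm leaves open the joint law of the random parameters beyond the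
  stated (pairwise) independence, and the choice of the selection and enumeration rules. The
  following is the set of all randomized algorithms that conform to it.\<close>

definition alg_A :: "real \<Rightarrow> real \<Rightarrow> real \<Rightarrow> nat \<Rightarrow> rand_alg set" where
  "alg_A p \<epsilon> \<delta> m =
     {map_pmf (det_alg p \<epsilon> \<delta> m sel e) P | P sel e.
        seed_law p \<epsilon> \<delta> m P \<and> selection_rule (A_D p \<epsilon> \<delta>) (A_k p \<epsilon>) sel \<and> enumeration_rule m e}"

end

theory Submission
  imports Defs
begin

text \<open>
  Call a coordinate heavy if \<open>\<bar>x\<^sub>i\<bar> > \<epsilon>\<close>; there are at most \<open>k\<^sub>0 = \<lfloor>\<epsilon>\<^bsup>-p\<^esup>\<rfloor>\<close> of them. The output is off by at
  most \<open>\<parallel>x\<parallel>\<^sub>\<infinity> \<le> 1\<close> in any case and by at most \<open>\<epsilon>\<close> if all heavy coordinates lie in \<open>K\<close>, so it suffices to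
  bound the probability that one is missed by \<open>\<delta>\<close>. There are three ways to miss one.

  (1) Its bucket has a remainder of \<open>p\<close>-norm at least \<open>\<epsilon>/\<gamma>\<close>: Markov's inequality gives probability at most
  \<open>\<delta>/(4 k\<^sub>0)\<close> for each heavy coordinate.

  (2) Its bucket is not selected. For a fixed bucket \<open>d\<close>, a coordinate colliding with \<open>d\<close> contributes
  at most \<open>min(1, (2x\<^sub>i/\<epsilon>)\<^sup>2) \<le> (2\<bar>x\<^sub>i\<bar>/\<epsilon>)\<^sup>p\<close> to the probability of noise above \<open>\<epsilon>/2\<close>, which is thus at
  most \<open>1/8\<close> per repetition. The median amplifies this to \<open>\<delta>/(4D)\<close>, and then at most \<open>k\<close> buckets,
  among them those of the heavy coordinates, have \<open>Z\<^sub>d > \<epsilon>/2\<close>.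

  (3) Spot misses it. As long as all steps succeed, \<open>S\<^sub>k\<close> is the set \<open>T\<^sub>k\<close> of the indices whose first \<open>k\<close>
  hash values agree with those of \<open>i\<close>; unlike \<open>S\<^sub>k\<close>, it does not depend on the signs. So step \<open>k\<close> fails with
  probability of order \<open>D\<^sub>k\<^sup>2 / (D\<^sub>0 \<cdots> D\<^bsub>k-1\<^esub>)\<close> times the initial relative \<open>l\<^sub>2\<close>-mass of the bucket, and these
  numbers decay geometrically. The final step is covered by the same bound, since \<open>m \<le> D\<^bsub>k*\<^esub>\<close>.
\<close>

section \<open>Independent discrete random variables\<close>

lemma prob_map_pmf: "measure_pmf.prob (map_pmf f P) A = measure_pmf.prob P {s. f s \<in> A}"
  by (simp add: vimage_def)

lemma indep_rv_map_pair:
  assumes "indep_rv P X Y"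
  shows "map_pmf (\<lambda>s. (X s, Y s)) P = pair_pmf (map_pmf X P) (map_pmf Y P)"
proof (rule pmf_eqI)
  fix ab :: "'b \<times> 'c"
  obtain a b where ab: "ab = (a, b)" by (cases ab)
  have "(\<lambda>s. (X s, Y s)) -` {(a, b)} = X -` {a} \<inter> Y -` {b}" by auto
  then show "pmf (map_pmf (\<lambda>s. (X s, Y s)) P) ab = pmf (pair_pmf (map_pmf X P) (map_pmf Y P)) ab"
    using prob_space.indep_setD[OF prob_space_measure_pmf, OF assms[unfolded indep_rv_def], of "X -` {a}" "Y -` {b}"]
    by (simp add: ab pmf_pair pmf_map)
qed

text \<open>Conditioning on \<open>X\<close>: the joint law is a product, so Tonelli's theorem
  integrates a bound that is known for each frozen value of \<open>X\<close>. Only values in the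
  support count, so frozen hash values may be assumed to lie in their ranges.\<close>

lemma indep_rv_prob_le:
  assumes ind: "indep_rv P X Y"
    and int: "integrable (measure_pmf P) (\<lambda>s. f (X s))"
    and le: "\<And>a. a \<in> X ` set_pmf P \<Longrightarrow> measure_pmf.prob P {s. Q a (Y s)} \<le> f a"
  shows "measure_pmf.prob P {s. Q (X s) (Y s)} \<le> measure_pmf.expectation P (\<lambda>s. f (X s))"
proof -
  have f0: "0 \<le> f (X s)" if "s \<in> set_pmf P" for s
    using le[of "X s"] that order_trans[OF measure_nonneg] by blast
  have "emeasure P {s. Q (X s) (Y s)} = emeasure (map_pmf (\<lambda>s. (X s, Y s)) P) {(a, b). Q a b}"
    by (simp add: vimage_def)
  also have "\<dots> = (\<integral>\<^sup>+ab. indicator {(a, b). Q a b} ab \<partial>pair_pmf (map_pmf X P) (map_pmf Y P))"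
    by (simp add: indep_rv_map_pair[OF ind])
  also have "\<dots> = (\<integral>\<^sup>+s. emeasure P {t. Q (X s) (Y t)} \<partial>P)"
    by (simp add: nn_integral_pair_pmf' indicator_def flip: nn_integral_indicator)
  also have "\<dots> \<le> (\<integral>\<^sup>+s. ennreal (f (X s)) \<partial>P)"
    by (rule nn_integral_mono_AE)
       (auto simp: AE_measure_pmf_iff measure_pmf.emeasure_eq_measure intro!: ennreal_leI le)
  also have "\<dots> = ennreal (measure_pmf.expectation P (\<lambda>s. f (X s)))"
    by (rule nn_integral_eq_integral[OF int]) (use f0 in \<open>auto simp: AE_measure_pmf_iff\<close>)
  finally show ?thesis
    using f0 by (simp add: measure_pmf.emeasure_eq_measure ennreal_le_iff
        Bochner_Integration.integral_nonneg_AE AE_measure_pmf_iff)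
qed

lemma indep_rv_prob_le_const:
  assumes "indep_rv P X Y"
    and "\<And>a. a \<in> X ` set_pmf P \<Longrightarrow> measure_pmf.prob P {s. Q a (Y s)} \<le> c"
  shows "measure_pmf.prob P {s. Q (X s) (Y s)} \<le> c"
  using indep_rv_prob_le[OF assms(1), of "\<lambda>_. c" Q] assms(2) by simp

lemma indep_vars_prob_all:
  assumes "prob_space.indep_vars (measure_pmf P) (\<lambda>_. count_space UNIV) X I" "finite I"
  shows "measure_pmf.prob P {s. \<forall>i\<in>I. X i s \<in> A i} = (\<Prod>i\<in>I. measure_pmf.prob P {s. X i s \<in> A i})"
proof (cases "I = {}")
  case False
  have "{s. \<forall>i\<in>I. X i s \<in> A i} = (\<Inter>i\<in>I. X i -` A i \<inter> space (measure_pmf P))"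
    using False by auto
  then show ?thesis
    using prob_space.indep_varsD_finite[OF prob_space_measure_pmf assms(1) False assms(2), of A] by (simp add: vimage_def)
qed simp

lemma indep_unif_imp_pairwise:
  assumes "indep_unif P I V X"
  shows "pairwise_indep_unif P I V X"
  unfolding pairwise_indep_unif_def
proof (intro conjI ballI impI)
  fix i j assume ij: "i \<in> I" "j \<in> I" "i \<noteq> j"
  have "measure_pmf.prob P (X i -` A \<inter> X j -` B)
          = measure_pmf.prob P (X i -` A) * measure_pmf.prob P (X j -` B)" for A B
  proof -
    have "prob_space.indep_vars (measure_pmf P) (\<lambda>_. count_space UNIV) X {i, j}"
      using assms ij unfolding indep_unif_def
      by (elim conjE prob_space.indep_vars_subset[OF prob_space_measure_pmf]) auto
    from indep_vars_prob_all[OF this, of "\<lambda>l. if l = i then A else B"] ij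
    show ?thesis by (simp add: vimage_def Int_def)
  qed
  then show "indep_rv P (X i) (X j)"
    unfolding indep_rv_def prob_space.indep_sets2_eq[OF prob_space_measure_pmf] by auto
qed (use assms in \<open>auto simp: indep_unif_def\<close>)

text \<open>Point masses factor over all entries, and such a product is a product over rows of
  products over columns. The default \<open>undefined\<close> is the value of
  \<open>restrict\<close> off the index sets; a function that violates it has mass 0 on both
  sides.\<close>

lemma indep_vars_rows_law:
  fixes P :: "'s pmf"
  assumes ind: "prob_space.indep_vars (measure_pmf P) (\<lambda>_. count_space UNIV) (\<lambda>(r, i). X r i) (T \<times> I)"
    and fin: "finite T" "finite I"
  shows "map_pmf (\<lambda>s. \<lambda>r\<in>T. \<lambda>i\<in>I. X r i s) P =
    Pi_pmf T undefined (\<lambda>r. Pi_pmf I undefined (\<lambda>i. map_pmf (X r i) P))" (is "map_pmf ?F P = ?R")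
proof (rule pmf_eqI)
  fix b
  show "pmf (map_pmf ?F P) b = pmf ?R b"
  proof (cases "(\<forall>r. r \<notin> T \<longrightarrow> b r = undefined) \<and> (\<forall>r\<in>T. \<forall>i. i \<notin> I \<longrightarrow> b r i = undefined)")
    case True
    then have "?F -` {b} = {s. \<forall>ri\<in>T \<times> I. (\<lambda>(r, i). X r i) ri s \<in> {b (fst ri) (snd ri)}}"
      by (auto simp: fun_eq_iff restrict_def)
    then have "pmf (map_pmf ?F P) b
        = (\<Prod>ri\<in>T \<times> I. measure_pmf.prob P {s. (\<lambda>(r, i). X r i) ri s \<in> {b (fst ri) (snd ri)}})"
      unfolding pmf_map using indep_vars_prob_all[OF ind, of "\<lambda>ri. {b (fst ri) (snd ri)}"] fin by simp
    also have "\<dots> = (\<Prod>r\<in>T. \<Prod>i\<in>I. pmf (map_pmf (X r i) P) (b r i))"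
      by (subst prod.cartesian_product) (auto intro!: prod.cong simp: pmf_map vimage_def)
    finally show ?thesis using True fin by (simp add: pmf_Pi)
  next
    case False
    then have "?F -` {b} = {}" by (auto simp: restrict_def)
    moreover have "pmf ?R b = 0"
    proof (cases "\<forall>r. r \<notin> T \<longrightarrow> b r = undefined")
      case True
      then obtain r i where "r \<in> T" "i \<notin> I" "b r i \<noteq> undefined" using False by auto
      then have "pmf (Pi_pmf I undefined (\<lambda>i. map_pmf (X r i) P)) (b r) = 0"
        using fin by (auto simp: pmf_Pi)
      then have "\<exists>r\<in>T. pmf (Pi_pmf I undefined (\<lambda>i. map_pmf (X r i) P)) (b r) = 0"
        using \<open>r \<in> T\<close> by blast
      then show ?thesis by (simp only: pmf_Pi[OF fin(1)] prod_zero[OF fin(1)] if_cancel)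
    qed (use fin in \<open>auto simp: pmf_Pi_outside\<close>)
    ultimately show ?thesis by (simp add: pmf_map)
  qed
qed

lemma indep_vars_rows_prob_all:
  assumes ind: "prob_space.indep_vars (measure_pmf P) (\<lambda>_. count_space UNIV) (\<lambda>(r, i). X r i) (T \<times> I)"
    and fin: "finite T" "finite I"
  shows "measure_pmf.prob P {s. \<forall>r\<in>T. (\<lambda>i\<in>I. X r i s) \<in> A r} =
    (\<Prod>r\<in>T. measure_pmf.prob P {s. (\<lambda>i\<in>I. X r i s) \<in> A r})"
proof -
  let ?F = "\<lambda>s. \<lambda>r\<in>T. \<lambda>i\<in>I. X r i s"
  note law = indep_vars_rows_law[OF ind fin]
  \<comment> \<open>Projecting the joint law to the component \<open>r\<close> identifies the inner
    product measure as the law of that row.\<close>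
  have row: "Pi_pmf I undefined (\<lambda>i. map_pmf (X r i) P) = map_pmf (\<lambda>s. \<lambda>i\<in>I. X r i s) P"
    if "r \<in> T" for r
  proof -
    have "map_pmf (\<lambda>b. b r) (map_pmf ?F P) = Pi_pmf I undefined (\<lambda>i. map_pmf (X r i) P)"
      unfolding law using that fin by (simp add: Pi_pmf_component)
    then show ?thesis using that by (simp add: pmf.map_comp o_def)
  qed
  have "measure_pmf.prob P {s. \<forall>r\<in>T. (\<lambda>i\<in>I. X r i s) \<in> A r} = measure_pmf.prob (map_pmf ?F P) (Pi T A)"
    unfolding prob_map_pmf by (rule arg_cong[of _ _ "measure_pmf.prob P"]) (force simp: Pi_iff)
  also have "\<dots> = (\<Prod>r\<in>T. measure_pmf.prob (Pi_pmf I undefined (\<lambda>i. map_pmf (X r i) P)) (A r))"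
    unfolding law by (rule measure_Pi_pmf_Pi[OF fin(1)])
  also have "\<dots> = (\<Prod>r\<in>T. measure_pmf.prob P {s. (\<lambda>i\<in>I. X r i s) \<in> A r})"
    by (intro prod.cong refl) (simp add: row vimage_def)
  finally show ?thesis .
qed

lemma pairwise_indep_unif_pair:
  assumes "pairwise_indep_unif P I V X" "i \<in> I" "j \<in> I" "i \<noteq> j"
  shows "map_pmf (\<lambda>s. (X i s, X j s)) P = pair_pmf (pmf_of_set V) (pmf_of_set V)"
  using assms indep_rv_map_pair[of P "X i" "X j"] by (auto simp: pairwise_indep_unif_def)

lemma pairwise_indep_unif_in:
  assumes "pairwise_indep_unif P I V X" "finite V" "V \<noteq> {}" "i \<in> I" "s \<in> set_pmf P"
  shows "X i s \<in> V"
proof -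
  have "X i s \<in> set_pmf (map_pmf (X i) P)" using assms(5) by simp
  then show ?thesis using assms(1-4) by (simp add: pairwise_indep_unif_def del: set_map_pmf)
qed

text \<open>The pair is uniform on \<open>V \<times> V\<close>, whose diagonal holds
  \<open>card V\<close> of the \<open>(card V)^2\<close> points.\<close>

lemma pairwise_indep_unif_collision:
  assumes "pairwise_indep_unif P I V X" "finite V" "V \<noteq> {}" "i \<in> I" "j \<in> I" "i \<noteq> j"
  shows "measure_pmf.prob P {s. X i s = X j s} = 1 / card V"
proof -
  have pp: "pair_pmf (pmf_of_set V) (pmf_of_set V) = pmf_of_set (V \<times> V)"
    using assms(2,3) by (intro pmf_eqI) (simp add: split_paired_all pmf_pair pmf_of_set indicator_def card_cartesian_product)
  have "measure_pmf.prob P {s. X i s = X j s} =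
      measure_pmf.prob (map_pmf (\<lambda>s. (X i s, X j s)) P) {(a, b). a = b}"
    by (simp add: vimage_def)
  also have "\<dots> = real (card ((V \<times> V) \<inter> {(a, b). a = b})) / real (card (V \<times> V))"
    unfolding pairwise_indep_unif_pair[OF assms(1,4,5,6)] pp
    using assms(2,3) by (subst measure_pmf_of_set) auto
  also have "(V \<times> V) \<inter> {(a, b). a = b} = (\<lambda>a. (a, a)) ` V" by auto
  also have "card \<dots> = card V" by (rule card_image) (auto simp: inj_on_def)
  finally show ?thesis using assms(2,3) by (simp add: card_cartesian_product)
qed

section \<open>Second moments and tails of sums with pairwise independent signs\<close>

context
  fixes P :: "'s pmf" and I :: "'i set" and \<sigma> :: "'i \<Rightarrow> 's \<Rightarrow> real"
  assumes sig: "pairwise_indep_unif P I {-1, 1} \<sigma>"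
begin

lemma sign_square: "i \<in> I \<Longrightarrow> s \<in> set_pmf P \<Longrightarrow> \<sigma> i s * \<sigma> i s = 1"
  using pairwise_indep_unif_in[OF sig] by fastforce

text \<open>The signs are orthonormal in mean square: off the diagonal the pair is uniform on the
  four sign patterns, whose products cancel. This is all that the second moments below use of their
  law.\<close>

lemma sign_product_moment:
  assumes "i \<in> I" "j \<in> I"
  shows "integrable (measure_pmf P) (\<lambda>s. \<sigma> i s * \<sigma> j s)"
    and "measure_pmf.expectation P (\<lambda>s. \<sigma> i s * \<sigma> j s) = (if i = j then 1 else 0)"
proof -
  have "integrable (measure_pmf P) (\<lambda>s. \<sigma> i s * \<sigma> j s) \<and>
    measure_pmf.expectation P (\<lambda>s. \<sigma> i s * \<sigma> j s) = (if i = j then 1 else 0)"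
  proof (cases "i = j")
    case True
    have ae: "AE s in measure_pmf P. \<sigma> i s * \<sigma> i s = 1"
      using sign_square[OF assms(1)] by (simp add: AE_measure_pmf_iff)
    show ?thesis
      using integrable_cong_AE[OF _ _ ae] integral_cong_AE[OF _ _ ae] True by simp
  next
    case False
    let ?V = "pmf_of_set {-1, 1 :: real}"
    have "pair_pmf ?V ?V = pmf_of_set ({-1, 1} \<times> {-1, 1})"
      by (intro pmf_eqI) (auto simp: pmf_pair indicator_def)
    also have "({-1, 1} \<times> {-1, 1}) = {(-1, -1), (-1, 1), (1, -1), (1, 1 :: real)}" by auto
    finally have law: "map_pmf (\<lambda>s. (\<sigma> i s, \<sigma> j s)) P = pmf_of_set {(-1, -1), (-1, 1), (1, -1), (1, 1)}"
      using pairwise_indep_unif_pair[OF sig assms False] by simp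
    have "integrable (measure_pmf (map_pmf (\<lambda>s. (\<sigma> i s, \<sigma> j s)) P)) (\<lambda>(a, b). a * b)"
      unfolding law by (rule integrable_measure_pmf_finite) simp
    moreover have "measure_pmf.expectation (map_pmf (\<lambda>s. (\<sigma> i s, \<sigma> j s)) P) (\<lambda>(a, b). a * b) = 0"
      unfolding law by (subst integral_pmf_of_set) auto
    ultimately show ?thesis using False by simp
  qed
  then show "integrable (measure_pmf P) (\<lambda>s. \<sigma> i s * \<sigma> j s)"
    "measure_pmf.expectation P (\<lambda>s. \<sigma> i s * \<sigma> j s) = (if i = j then 1 else 0)" by auto
qed

lemma sign_sum_second_moment:
  assumes "finite A" "A \<subseteq> I"
  shows "integrable (measure_pmf P) (\<lambda>s. (\<Sum>i\<in>A. c i * \<sigma> i s)\<^sup>2)"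
    and "measure_pmf.expectation P (\<lambda>s. (\<Sum>i\<in>A. c i * \<sigma> i s)\<^sup>2) = (\<Sum>i\<in>A. (c i)\<^sup>2)"
proof -
  have eq: "(\<Sum>i\<in>A. c i * \<sigma> i s)\<^sup>2 = (\<Sum>i\<in>A. \<Sum>j\<in>A. (c i * c j) * (\<sigma> i s * \<sigma> j s))" for s
    by (simp add: power2_eq_square sum_product algebra_simps)
  have int: "integrable (measure_pmf P) (\<lambda>s. (c i * c j) * (\<sigma> i s * \<sigma> j s))" if "i \<in> A" "j \<in> A" for i j
    using that assms sign_product_moment(1) by (intro integrable_mult_right) auto
  show "integrable (measure_pmf P) (\<lambda>s. (\<Sum>i\<in>A. c i * \<sigma> i s)\<^sup>2)"
    unfolding eq by (intro Bochner_Integration.integrable_sum int)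
  have "measure_pmf.expectation P (\<lambda>s. (\<Sum>i\<in>A. c i * \<sigma> i s)\<^sup>2) =
      (\<Sum>i\<in>A. \<Sum>j\<in>A. measure_pmf.expectation P (\<lambda>s. (c i * c j) * (\<sigma> i s * \<sigma> j s)))"
    unfolding eq
    by (subst Bochner_Integration.integral_sum, intro Bochner_Integration.integrable_sum int)
       (auto intro!: sum.cong Bochner_Integration.integral_sum int simp del: integral_mult_right_zero)
  also have "\<dots> = (\<Sum>i\<in>A. \<Sum>j\<in>A. if i = j then c i * c j else 0)"
    using assms sign_product_moment(2) by (intro sum.cong refl) (auto simp: subset_iff)
  also have "\<dots> = (\<Sum>i\<in>A. (c i)\<^sup>2)"
    using assms by (simp add: sum.delta power2_eq_square)
  finally show "measure_pmf.expectation P (\<lambda>s. (\<Sum>i\<in>A. c i * \<sigma> i s)\<^sup>2) = (\<Sum>i\<in>A. (c i)\<^sup>2)" .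
qed

end

lemma prob_le_expectation:
  assumes "integrable (measure_pmf P) f" "\<And>s. 0 \<le> f s" "\<And>s. s \<in> E \<Longrightarrow> 1 \<le> f s"
  shows "measure_pmf.prob P E \<le> measure_pmf.expectation P f"
proof -
  have "measure_pmf.prob P E = measure_pmf.expectation P (indicator E)" by simp
  also have "\<dots> \<le> measure_pmf.expectation P f"
    using assms by (intro integral_mono) (auto simp: indicator_def integrable_real_indicator measure_pmf.emeasure_eq_measure)
  finally show ?thesis .
qed

lemma sign_sum_chebyshev:
  assumes "pairwise_indep_unif P I {-1, 1} \<sigma>" "finite A" "A \<subseteq> I" "0 < t"
  shows "measure_pmf.prob P {s. t \<le> \<bar>\<Sum>i\<in>A. c i * \<sigma> i s\<bar>} \<le> (\<Sum>i\<in>A. (c i)\<^sup>2) / t\<^sup>2"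
proof -
  note m = sign_sum_second_moment[OF assms(1-3), of c]
  have sq: "t\<^sup>2 \<le> y\<^sup>2" if "t \<le> \<bar>y\<bar>" for y
    using power_mono[OF that, of 2] assms(4) by simp
  have "measure_pmf.prob P {s. t \<le> \<bar>\<Sum>i\<in>A. c i * \<sigma> i s\<bar>} \<le>
      measure_pmf.expectation P (\<lambda>s. (\<Sum>i\<in>A. c i * \<sigma> i s)\<^sup>2 / t\<^sup>2)"
    using m(1) assms(4) by (intro prob_le_expectation) (auto simp: le_divide_eq sq)
  then show ?thesis by (simp add: m(2))
qed

text \<open>The two sums are combined as in the success condition of a shrinking step, with
  \<open>M\<close> bounding the hash differences. Markov's inequality is applied to the square; the
  weights 10 and 40/9 satisfy \<open>10 + 40/9 * M^2 \<le> 5 * M^2\<close> exactly when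
  \<open>M^2 \<ge> 18\<close>.\<close>

lemma sign_sums_tail:
  assumes "pairwise_indep_unif P I {-1, 1} \<sigma>" "finite A" "A \<subseteq> I" "0 < t"
    and g: "\<And>i. i \<in> A \<Longrightarrow> \<bar>g i\<bar> \<le> M" and M: "18 \<le> M\<^sup>2"
  shows "measure_pmf.prob P {s. t \<le> \<bar>\<Sum>i\<in>A. c i * \<sigma> i s\<bar> + 2 * \<bar>\<Sum>i\<in>A. g i * c i * \<sigma> i s\<bar>} \<le>
    5 * M\<^sup>2 * (\<Sum>i\<in>A. (c i)\<^sup>2) / t\<^sup>2"
proof -
  let ?B = "\<lambda>s. \<Sum>i\<in>A. c i * \<sigma> i s" and ?A = "\<lambda>s. \<Sum>i\<in>A. g i * c i * \<sigma> i s"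
  note mB = sign_sum_second_moment[OF assms(1-3), of c]
    and mA = sign_sum_second_moment[OF assms(1-3), of "\<lambda>i. g i * c i"]
  \<comment> \<open>the square of \<open>3\<bar>B\<bar> - (2/3)\<bar>A\<bar>\<close> is nonnegative\<close>
  have ineq: "(\<bar>b\<bar> + 2 * \<bar>a\<bar>)\<^sup>2 \<le> 10 * b\<^sup>2 + 40 / 9 * a\<^sup>2" for a b :: real
    using zero_le_power2[of "3 * \<bar>b\<bar> - 2 / 3 * \<bar>a\<bar>"] 
    by (simp add: power2_sum power2_diff power_mult_distrib power_divide mult.commute)
  have "measure_pmf.prob P {s. t \<le> \<bar>?B s\<bar> + 2 * \<bar>?A s\<bar>} \<le>
      measure_pmf.expectation P (\<lambda>s. (10 * (?B s)\<^sup>2 + 40 / 9 * (?A s)\<^sup>2) / t\<^sup>2)"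
  proof (rule prob_le_expectation)
    fix s assume "s \<in> {s. t \<le> \<bar>?B s\<bar> + 2 * \<bar>?A s\<bar>}"
    then have "t\<^sup>2 \<le> (\<bar>?B s\<bar> + 2 * \<bar>?A s\<bar>)\<^sup>2" using assms(4) by (intro power_mono) auto
    also note ineq
    finally show "1 \<le> (10 * (?B s)\<^sup>2 + 40 / 9 * (?A s)\<^sup>2) / t\<^sup>2"
      using assms(4) by (simp add: le_divide_eq)
  qed (use mA(1) mB(1) in auto)
  also have "\<dots> = (10 * (\<Sum>i\<in>A. (c i)\<^sup>2) + 40 / 9 * (\<Sum>i\<in>A. (g i * c i)\<^sup>2)) / t\<^sup>2"
    using mA mB by simp
  also have "\<dots> \<le> 5 * M\<^sup>2 * (\<Sum>i\<in>A. (c i)\<^sup>2) / t\<^sup>2"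
  proof (rule divide_right_mono)
    have "(g i)\<^sup>2 \<le> M\<^sup>2" if "i \<in> A" for i
      using power_mono[OF g[OF that], of 2] by simp
    then have "(\<Sum>i\<in>A. (g i * c i)\<^sup>2) \<le> (\<Sum>i\<in>A. M\<^sup>2 * (c i)\<^sup>2)"
      by (intro sum_mono) (simp add: power_mult_distrib mult_right_mono)
    then have "10 * (\<Sum>i\<in>A. (c i)\<^sup>2) + 40 / 9 * (\<Sum>i\<in>A. (g i * c i)\<^sup>2) \<le>
        (10 + 40 / 9 * M\<^sup>2) * (\<Sum>i\<in>A. (c i)\<^sup>2)"
      by (simp add: sum_distrib_left[symmetric] algebra_simps)
    also have "\<dots> \<le> 5 * M\<^sup>2 * (\<Sum>i\<in>A. (c i)\<^sup>2)"
      using M by (intro mult_right_mono sum_nonneg) auto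
    finally show "10 * (\<Sum>i\<in>A. (c i)\<^sup>2) + 40 / 9 * (\<Sum>i\<in>A. (g i * c i)\<^sup>2) \<le> 5 * M\<^sup>2 * (\<Sum>i\<in>A. (c i)\<^sup>2)" .
  qed simp
  finally show ?thesis .
qed

section \<open>Runs of the algorithm\<close>

lemma run_bind [simp]: "run m x (bind_alg A c) = run m x (c (run m x A))"
  by (induction A) auto

lemma num_meas_bind [simp]:
  "num_meas m x (bind_alg A c) = num_meas m x A + num_meas m x (c (run m x A))"
  by (induction A) auto

lemma run_measure_family:
  "run m x (measure_family js a) = (\<lambda>j. if j \<in> set js then \<Sum>i\<in>{1..m}. a j i * x i else 0)"
  by (induction js) (auto simp: fun_eq_iff)

lemma num_meas_measure_family [simp]: "num_meas m x (measure_family js a) = length js"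
  by (induction js) auto

lemma run_union_alg [simp]: "run m x (union_alg js A) = (\<Union>j\<in>set js. run m x (A j))"
  by (induction js) auto

lemma num_meas_union_alg:
  "num_meas m x (union_alg js A) = (\<Sum>j\<leftarrow>js. num_meas m x (A j))"
  by (induction js) auto

text \<open>The statistic \<open>Z_d\<close> as an explicit function of the input. The guards make
  it agree with the program for every seed: a functional outside the measured family reads as 0, and
  a coordinate hashed outside \<open>{1..D}\<close> belongs to no measured bucket.\<close>

definition bucket_stat ::
  "nat \<Rightarrow> (nat \<Rightarrow> real) \<Rightarrow> nat \<Rightarrow> nat \<Rightarrow> nat \<Rightarrow>
   (nat \<Rightarrow> nat) \<Rightarrow> (nat \<Rightarrow> nat \<Rightarrow> nat) \<Rightarrow> (nat \<Rightarrow> nat \<Rightarrow> real) \<Rightarrow> nat \<Rightarrow> real" where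
  "bucket_stat m x D R G h H \<sigma> d =
     median (map (\<lambda>r. \<bar>if H r d \<in> {1..G} then
       \<Sum>i\<in>{i\<in>{1..m}. h i \<in> {1..D} \<and> H r (h i) = H r d}. x i * \<sigma> r i else 0\<bar>) [1..<Suc R])"

lemma run_bucket_select:
  "run m x (bucket_select m D R G sel h H \<sigma>) = sel (\<lambda>d\<in>{1..D}. bucket_stat m x D R G h H \<sigma> d)"
proof -
  \<comment> \<open>The coordinate \<open>i\<close> lies in the single bucket \<open>h i\<close>, so
    at most one term of the inner sum survives.\<close>
  have coeff: "(\<Sum>d\<in>{d\<in>{1..D}. H r d = g}. if i \<in> bucket m h d then \<sigma> r i else 0) =
      (if h i \<in> {1..D} \<and> H r (h i) = g then \<sigma> r i else 0)" if "i \<in> {1..m}" for r g i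
  proof -
    have "(\<Sum>d\<in>{d\<in>{1..D}. H r d = g}. if i \<in> bucket m h d then \<sigma> r i else 0) =
        (\<Sum>d\<in>{d\<in>{1..D}. H r d = g}. if h i = d then \<sigma> r i else 0)"
      using that by (intro sum.cong) (auto simp: bucket_def)
    then show ?thesis by (simp add: sum.delta')
  qed
  have sums: "(\<Sum>i\<in>{1..m}. (\<Sum>d\<in>{d\<in>{1..D}. H r d = g}. if i \<in> bucket m h d then \<sigma> r i else 0) * x i) =
      (\<Sum>i\<in>{i\<in>{1..m}. h i \<in> {1..D} \<and> H r (h i) = g}. x i * \<sigma> r i)" for r g
    by (subst sum.inter_filter, simp, rule sum.cong[OF refl], subst coeff, simp_all)
  show ?thesis
    unfolding bucket_select_def bucket_stat_def run_bind run_measure_family run.simps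
    by (intro arg_cong[where f = sel] restrict_ext arg_cong[where f = median] map_cong refl)
       (simp only: prod.case sums set_product mem_Sigma_iff set_upt atLeastLessThanSuc_atLeastAtMost simp_thms)
qed

lemma num_meas_bucket_select [simp]:
  "num_meas m x (bucket_select m D R G sel h H \<sigma>) = R * G"
  by (simp add: bucket_select_def length_product)

section \<open>Runs of Shrink and Spot\<close>

lemma num_meas_shrink [simp]: "num_meas m x (shrink D0 h \<sigma> S) = 2"
  by (simp add: shrink_def)

lemma run_shrink_subset: "run m x (shrink D0 h \<sigma> S) \<subseteq> S"
  by (auto simp: shrink_def)

text \<open>The two sums are the perturbations of \<open>Y\<^sub>1\<close> and of \<open>Y\<^sub>2 - (h\<^sub>i - (D\<^sub>0 + 1)/2) Y\<^sub>1\<close> by the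
  coordinates other than \<open>i\<close>; the hypothesis keeps \<open>Y\<^sub>2/Y\<^sub>1 + D\<^sub>0/2\<close> within \<open>1/2\<close> of \<open>h\<^sub>i - 1/2\<close>.\<close>

lemma run_shrink:
  assumes S: "S \<subseteq> {1..m}" "i \<in> S" and sgn: "\<bar>\<sigma> i\<bar> = 1"
    and dom: "\<bar>\<Sum>j\<in>S - {i}. x j * \<sigma> j\<bar>
      + 2 * \<bar>\<Sum>j\<in>S - {i}. (real (h j) - real (h i)) * x j * \<sigma> j\<bar> < \<bar>x i\<bar>"
  shows "run m x (shrink D0 h \<sigma> S) = {j \<in> S. h j = h i}"
proof -
  define B where "B = (\<Sum>j\<in>S - {i}. x j * \<sigma> j)"
  define A where "A = (\<Sum>j\<in>S - {i}. (real (h j) - real (h i)) * x j * \<sigma> j)"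
  define c where "c = real (h i) - (real D0 + 1) / 2"
  define Y1 where "Y1 = (\<Sum>j\<in>{1..m}. (if j \<in> S then \<sigma> j else 0) * x j)"
  define Y2 where "Y2 = (\<Sum>j\<in>{1..m}. (if j \<in> S then (real (h j) - (real D0 + 1) / 2) * \<sigma> j else 0) * x j)"
  have fin: "finite S" using S finite_subset by blast
  have eq: "(\<Sum>j\<in>{1..m}. (if j \<in> S then f j else 0) * x j) = f i * x i + (\<Sum>j\<in>S - {i}. f j * x j)" for f
  proof -
    have "(\<Sum>j\<in>{1..m}. (if j \<in> S then f j else 0) * x j) = (\<Sum>j\<in>S. f j * x j)"
      using S by (intro sum.mono_neutral_cong_right) auto
    then show ?thesis using fin S by (simp add: sum.remove[of S i])
  qed
  have Y1: "Y1 = \<sigma> i * x i + B" unfolding Y1_def B_def eq by (simp add: mult.commute)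
  have "Y2 = c * (\<sigma> i * x i) + (\<Sum>j\<in>S - {i}. (real (h j) - (real D0 + 1) / 2) * \<sigma> j * x j)"
    unfolding Y2_def eq c_def by simp
  also have "(\<Sum>j\<in>S - {i}. (real (h j) - (real D0 + 1) / 2) * \<sigma> j * x j) = c * B + A"
    unfolding A_def B_def c_def sum_distrib_left sum.distrib[symmetric]
    by (intro sum.cong refl) (simp add: algebra_simps)
  finally have Y2: "Y2 = c * Y1 + A" by (simp add: Y1 algebra_simps)
  have "\<bar>\<sigma> i * x i\<bar> = \<bar>x i\<bar>" using sgn by (simp add: abs_mult)
  \<comment> \<open>Since \<open>\<bar>Y1\<bar> \<ge> \<bar>x i\<bar> - \<bar>B\<bar>\<close>, the
    hypothesis both excludes the empty output and bounds \<open>A / Y1\<close> by 1/2.\<close>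
  then have lt: "2 * \<bar>A\<bar> < \<bar>Y1\<bar>" using dom unfolding Y1 A_def B_def by linarith
  then have Y10: "Y1 \<noteq> 0" by auto
  have "\<bar>A / Y1\<bar> < 1 / 2" using lt Y10 by (simp add: abs_divide divide_simps)
  moreover have "Y2 / Y1 + real D0 / 2 = real (h i) - 1 / 2 + A / Y1"
    using Y10 by (simp add: Y2 c_def field_simps)
  moreover have "real_of_int (int (h i)) = real (h i)" by simp
  ultimately have "\<lceil>Y2 / Y1 + real D0 / 2\<rceil> = int (h i)"
    by (intro ceiling_unique) linarith+
  then show ?thesis using Y10 unfolding shrink_def by (auto simp: Y1_def Y2_def)
qed

text \<open>A successful step turns \<open>T k\<close> into \<open>T (Suc k)\<close>, so the
  induction runs over the steps that remain. An early exit is harmless because every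
  \<open>T k\<close> contains \<open>i\<close>. The function \<open>g\<close> gathers the hash
  vectors in use, including the injective one of the final step, so that one condition covers all
  steps.\<close>

lemma run_spot_from:
  fixes x :: "nat \<Rightarrow> real"
  assumes J: "J \<subseteq> {1..m}" "i \<in> J" and "k \<le> ks"
    and sgn: "\<And>k. k \<le> ks \<Longrightarrow> \<bar>\<sigma> k i\<bar> = 1"
    and T: "\<And>k. T k = {j \<in> J. \<forall>l<k. H l j = H l i}"
    and g: "\<And>k. g k = (if k < ks then H k else e (T k))"
    and dom: "\<And>k. k \<le> ks \<Longrightarrow> \<bar>\<Sum>j\<in>T k - {i}. x j * \<sigma> k j\<bar>
      + 2 * \<bar>\<Sum>j\<in>T k - {i}. (real (g k j) - real (g k i)) * x j * \<sigma> k j\<bar> < \<bar>x i\<bar>"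
  shows "i \<in> run m x (spot_from ks \<alpha> e H \<sigma> k (T k))"
  using \<open>k \<le> ks\<close>
proof (induction "ks - k" arbitrary: k)
  case 0
  then have k: "k = ks" by simp
  have iT: "i \<in> T k" "T k \<subseteq> {1..m}" using J by (auto simp: T)
  show ?case
    using run_shrink[where ?D0.0 = "card (T k)", OF iT(2,1) sgn dom] iT by (auto simp: spot_from.simps[of ks] k g)
next
  case (Suc n)
  have iT: "i \<in> T k" "T k \<subseteq> {1..m}" using J by (auto simp: T)
  have "{j \<in> T k. H k j = H k i} = T (Suc k)" by (auto simp: T less_Suc_eq)
  moreover have "i \<in> run m x (spot_from ks \<alpha> e H \<sigma> (Suc k) (T (Suc k)))"
    using Suc by auto
  ultimately show ?case
    using run_shrink[where ?D0.0 = "spot_D \<alpha> k", OF iT(2,1) sgn dom] iT Suc.hyps(2) Suc.prems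
    by (auto simp: spot_from.simps[of ks \<alpha> e H \<sigma> k] g)
qed

lemma run_spot_from_subset: "run m x (spot_from ks \<alpha> e H \<sigma> k S) \<subseteq> S"
proof (induction ks \<alpha> e H \<sigma> k S rule: spot_from.induct)
  case (1 ks \<alpha> e H \<sigma> k S)
  show ?case
  proof (cases "card S \<le> 1 \<or> \<not> k < ks")
    case True then show ?thesis using run_shrink_subset by (subst spot_from.simps) auto
  next
    case False
    then show ?thesis
      using "1.IH"[of "run m x (shrink (spot_D \<alpha> k) (H k) (\<sigma> k) S)"]
        run_shrink_subset[of m x "spot_D \<alpha> k" "H k" "\<sigma> k" S]
      by (subst spot_from.simps) auto
  qed
qed

lemma num_meas_spot_from: "num_meas m x (spot_from ks \<alpha> e H \<sigma> k S) \<le> 2 * (ks - k) + 2"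
proof (induction ks \<alpha> e H \<sigma> k S rule: spot_from.induct)
  case (1 ks \<alpha> e H \<sigma> k S)
  show ?case
  proof (cases "card S \<le> 1 \<or> \<not> k < ks")
    case True then show ?thesis by (subst spot_from.simps) auto
  next
    case False
    then show ?thesis
      using "1.IH"[of "run m x (shrink (spot_D \<alpha> k) (H k) (\<sigma> k) S)"]
      by (subst spot_from.simps) auto
  qed
qed

text \<open>An early exit leaves at most one index, and in the final step the hash vector is
  injective, so at most one index carries the decoded value. This bounds the number of coordinates
  observed directly at the end.\<close>

lemma card_run_spot_from:
  assumes "enumeration_rule m e" "S \<subseteq> {1..m}"
  shows "card (run m x (spot_from ks \<alpha> e H \<sigma> k S)) \<le> 1"
  using assms
proof (induction ks \<alpha> e H \<sigma> k S rule: spot_from.induct)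
  case (1 ks \<alpha> e H \<sigma> k S)
  consider "card S \<le> 1" | "\<not> card S \<le> 1" "k < ks" | "\<not> card S \<le> 1" "\<not> k < ks" by blast
  then show ?case
  proof cases
    case 2
    then show ?thesis
      using "1.IH"[OF 2] "1.prems" run_shrink_subset[of m x "spot_D \<alpha> k" "H k" "\<sigma> k" S]
      by (subst spot_from.simps) auto
  next
    case 3
    have inj: "inj_on (e S) S" using "1.prems" by (auto simp: enumeration_rule_def)
    have "card {i \<in> S. int (e S i) = z} \<le> 1" for z
      using inj by (intro card_le_Suc0_iff_eq[THEN iffD2, folded One_nat_def])
        (auto simp: inj_on_def intro: finite_subset[OF _ finite_subset[OF "1.prems"(2)]])
    then show ?thesis using 3 by (subst spot_from.simps) (auto simp: shrink_def)
  qed (subst spot_from.simps, auto)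
qed

lemma run_det_alg:
  assumes "finite K"
    "K = run m x (union_alg (sorted_list_of_set
            (run m x (bucket_select m (A_D p \<epsilon> \<delta>) (A_R p \<epsilon> \<delta>) (A_G p \<epsilon>) sel
              (bucket_hash s) (sel_hash s) (sel_sign s))))
          (\<lambda>d. spot m (A_alpha p \<epsilon> \<delta>) e (spot_hash s d) (spot_sign s d)
                 (bucket m (bucket_hash s) d)))"
    "i \<in> {1..m}"
  shows "run m x (det_alg p \<epsilon> \<delta> m sel e s) i = (if i \<in> K then x i else 0)"
proof -
  have "(\<Sum>l\<in>{1..m}. (if l = i then 1 else 0) * x l) = x i"
    using assms(3) by (simp add: if_distrib[of "\<lambda>u. u * _"] sum.delta cong: if_cong)
  then show ?thesis
    using assms(1,3) unfolding det_alg_def run_bind assms(2)[symmetric] run_measure_family by simp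
qed

section \<open>Selection of the heavy buckets\<close>

lemma square_le_powr:
  fixes u p :: real
  assumes "0 \<le> u" "u \<le> 1" "p \<le> 2"
  shows "u\<^sup>2 \<le> u powr p"
proof (cases "u = 0")
  case False
  then have "u\<^sup>2 = u powr 2" using assms by simp
  also have "\<dots> \<le> u powr p" using assms by (intro powr_mono') auto
  finally show ?thesis .
qed simp

text \<open>Either one ratio exceeds 1 and its term alone suffices, or all ratios are at most 1 and
  their squares are dominated by their \<open>p\<close>-th powers. In this form a bound in the
  \<open>p\<close>-norm controls the \<open>l_2\<close>-mass of a bucket.\<close>

lemma sum_powr_ge_one:
  fixes x :: "'i \<Rightarrow> real"
  assumes "finite A" "0 < t" "0 \<le> p" "p \<le> 2" and gt: "t\<^sup>2 < (\<Sum>i\<in>A. (x i)\<^sup>2)"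
  shows "1 \<le> (\<Sum>i\<in>A. (\<bar>x i\<bar> / t) powr p)"
proof (cases "\<exists>i\<in>A. t < \<bar>x i\<bar>")
  case True
  then obtain i where i: "i \<in> A" "t < \<bar>x i\<bar>" by blast
  have "1 \<le> (\<bar>x i\<bar> / t) powr p" using i assms by (intro ge_one_powr_ge_zero) auto
  also have "\<dots> \<le> (\<Sum>i\<in>A. (\<bar>x i\<bar> / t) powr p)" using i assms by (intro member_le_sum) auto
  finally show ?thesis .
next
  case False
  have "1 \<le> (\<Sum>i\<in>A. (\<bar>x i\<bar> / t)\<^sup>2)"
    using gt assms by (simp add: power_divide flip: sum_divide_distrib)
  also have "\<dots> \<le> (\<Sum>i\<in>A. (\<bar>x i\<bar> / t) powr p)"
    using False assms by (intro sum_mono square_le_powr) (auto simp: not_less)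
  finally show ?thesis .
qed

section \<open>Medians and repeated trials\<close>

lemma median_le_imp_many:
  assumes "median ys \<le> t" "ys \<noteq> []"
  shows "length ys div 2 < length (filter (\<lambda>y. y \<le> t) ys)"
proof -
  let ?zs = "sort ys" and ?n = "length ys div 2"
  have n: "?n < length ?zs" using assms(2) by (simp add: div_less_dividend)
  have "{..?n} \<subseteq> {i. i < length ?zs \<and> ?zs ! i \<le> t}"
    using assms(1) n order_trans[OF sorted_nth_mono[of ?zs _ ?n]] by (auto simp: median_def)
  then have "card {..?n} \<le> card {i. i < length ?zs \<and> ?zs ! i \<le> t}" by (intro card_mono) auto
  also have "\<dots> = length (filter (\<lambda>y. y \<le> t) ?zs)" by (simp add: length_filter_conv_card)
  also have "\<dots> = length (filter (\<lambda>y. y \<le> t) ys)"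
    by (metis mset_filter mset_sort size_mset)
  finally show ?thesis by simp
qed

text \<open>The values from the middle position on are at least the median. Odd length makes these
  positions a strict majority; for even length they would be exactly one half.\<close>

lemma median_gt_imp_many:
  assumes "t < median ys" "odd (length ys)"
  shows "length ys div 2 < length (filter (\<lambda>y. t < y) ys)"
proof -
  let ?zs = "sort ys" and ?n = "length ys div 2"
  have len: "length ys = 2 * ?n + 1" using assms(2) by presburger
  have "{?n..<length ?zs} \<subseteq> {i. i < length ?zs \<and> t < ?zs ! i}"
    using assms(1) less_le_trans[OF _ sorted_nth_mono[of ?zs ?n]] by (auto simp: median_def)
  then have "card {?n..<length ?zs} \<le> card {i. i < length ?zs \<and> t < ?zs ! i}" by (intro card_mono) auto
  also have "\<dots> = length (filter (\<lambda>y. t < y) ?zs)" by (simp add: length_filter_conv_card)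
  also have "\<dots> = length (filter (\<lambda>y. t < y) ys)"
    by (metis mset_filter mset_sort size_mset)
  finally show ?thesis using len by simp
qed

lemma length_filter_upt: "length (filter P (map f [1..<Suc R])) = card {r \<in> {1..R}. P (f r)}"
proof -
  have "length (filter P (map f [1..<Suc R])) = card (set (filter (\<lambda>r. P (f r)) [1..<Suc R]))"
    by (subst distinct_card) (simp_all add: filter_map o_def del: upt_Suc)
  also have "set (filter (\<lambda>r. P (f r)) [1..<Suc R]) = {r \<in> {1..R}. P (f r)}" by auto
  finally show ?thesis .
qed

text \<open>A union bound over the \<open>n\<close>-subsets of trials. The hypothesis is about joint
  failure, which is what averaging over independent repetitions delivers.\<close>

lemma prob_many_failures:
  assumes "finite K" and q: "\<And>T. T \<subseteq> K \<Longrightarrow> measure_pmf.prob P {s. \<forall>r\<in>T. E r s} \<le> q ^ card T"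
  shows "measure_pmf.prob P {s. n \<le> card {r \<in> K. E r s}} \<le> real (card K choose n) * q ^ n"
proof -
  let ?\<T> = "{T. T \<subseteq> K \<and> card T = n}"
  have fin: "finite ?\<T>" using assms(1) by simp
  have "{s. n \<le> card {r \<in> K. E r s}} \<subseteq> (\<Union>T\<in>?\<T>. {s. \<forall>r\<in>T. E r s})"
  proof
    fix s assume "s \<in> {s. n \<le> card {r \<in> K. E r s}}"
    then obtain T where "T \<subseteq> {r \<in> K. E r s}" "card T = n"
      using obtain_subset_with_card_n[of n "{r \<in> K. E r s}"] by auto
    then show "s \<in> (\<Union>T\<in>?\<T>. {s. \<forall>r\<in>T. E r s})" by (auto intro!: exI[of _ T])
  qed
  then have "measure_pmf.prob P {s. n \<le> card {r \<in> K. E r s}} \<le>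
      measure_pmf.prob P (\<Union>T\<in>?\<T>. {s. \<forall>r\<in>T. E r s})"
    by (intro measure_pmf.finite_measure_mono) auto
  also have "\<dots> \<le> (\<Sum>T\<in>?\<T>. measure_pmf.prob P {s. \<forall>r\<in>T. E r s})"
    using fin by (intro measure_pmf.finite_measure_subadditive_finite) auto
  also have "\<dots> \<le> (\<Sum>T\<in>?\<T>. q ^ n)" using q by (intro sum_mono) force
  finally show ?thesis using n_subsets[OF assms(1), of n] by simp
qed

lemma random_vector_collision:
  assumes "map_pmf X P = pmf_of_set (A \<rightarrow>\<^sub>E B)" "finite A" "finite B" "B \<noteq> {}" "a \<in> A" "b \<in> A" "a \<noteq> b"
  shows "measure_pmf.prob P {s. X s a = X s b} = 1 / card B"
proof -
  let ?Q = "Pi_pmf A undefined (\<lambda>_. pmf_of_set B)"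
  have "A \<rightarrow>\<^sub>E B = PiE_dflt A undefined (\<lambda>_. B)" by (auto simp: PiE_dflt_def PiE_def extensional_def)
  then have law: "map_pmf X P = ?Q" using assms by (simp add: Pi_pmf_of_set)
  have "indep_unif ?Q A B (\<lambda>a f. f a)"
    unfolding indep_unif_def using assms(2) by (auto simp: Pi_pmf_component intro: indep_vars_Pi_pmf)
  then have "measure_pmf.prob ?Q {f. f a = f b} = 1 / card B"
    using assms by (intro pairwise_indep_unif_collision indep_unif_imp_pairwise) auto
  then show ?thesis by (simp add: vimage_def flip: law)
qed

section \<open>Noise in the measurements of a fixed bucket\<close>

definition noisy :: "(nat \<Rightarrow> real) \<Rightarrow> real \<Rightarrow> (nat \<Rightarrow> nat) \<Rightarrow> nat \<Rightarrow> nat set \<Rightarrow> (nat \<Rightarrow> nat) \<Rightarrow> (nat \<Rightarrow> real) \<Rightarrow> bool" where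
  "noisy x t h d W g \<tau> \<longleftrightarrow> t < \<bar>\<Sum>i\<in>{i\<in>W. g (h i) = g d}. x i * \<tau> i\<bar>"

text \<open>For a coordinate of another bucket and \<open>t > 0\<close> this is the minimum of 1 and
  \<open>(x i / t)^2\<close>. A coordinate of bucket \<open>d\<close> itself collides with
  certainty, so there the square is kept; it is controlled by the small mass of the bucket.\<close>

definition noise_weight :: "(nat \<Rightarrow> real) \<Rightarrow> real \<Rightarrow> (nat \<Rightarrow> nat) \<Rightarrow> nat \<Rightarrow> nat \<Rightarrow> real" where
  "noise_weight x t h d i = (if t < \<bar>x i\<bar> \<and> h i \<noteq> d then 1 else (x i / t)\<^sup>2)"

definition noise_bound :: "(nat \<Rightarrow> real) \<Rightarrow> real \<Rightarrow> (nat \<Rightarrow> nat) \<Rightarrow> nat \<Rightarrow> nat set \<Rightarrow> (nat \<Rightarrow> nat) \<Rightarrow> real" where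
  "noise_bound x t h d W g = (\<Sum>i\<in>W. noise_weight x t h d i * of_bool (g (h i) = g d))"

lemma noise_weight_nonneg: "0 \<le> noise_weight x t h d i"
  by (simp add: noise_weight_def)

lemma noise_bound_nonneg: "0 \<le> noise_bound x t h d W g"
  by (auto simp: noise_bound_def noise_weight_nonneg intro!: sum_nonneg)

text \<open>If a coordinate larger than \<open>t\<close> collides with \<open>d\<close>, the bound is at least \<open>1\<close>; otherwise
  it is the one given by Chebyshev's inequality.\<close>

lemma prob_noisy_le:
  assumes \<sigma>: "pairwise_indep_unif P I {-1, 1} \<sigma>" and W: "finite W" "W \<subseteq> I" and t: "0 < t"
  shows "measure_pmf.prob P {s. noisy x t h d W g (\<lambda>i. \<sigma> i s)} \<le> noise_bound x t h d W g"
proof (cases "\<exists>i\<in>W. g (h i) = g d \<and> t < \<bar>x i\<bar> \<and> h i \<noteq> d")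
  case True
  then obtain i where i: "i \<in> W" "g (h i) = g d" "t < \<bar>x i\<bar>" "h i \<noteq> d" by blast
  have "1 = noise_weight x t h d i * of_bool (g (h i) = g d)" using i by (simp add: noise_weight_def)
  also have "\<dots> \<le> noise_bound x t h d W g"
    unfolding noise_bound_def using W i by (intro member_le_sum) (auto simp: noise_weight_nonneg)
  finally show ?thesis using measure_pmf.prob_le_1 order_trans by blast
next
  case False
  let ?A = "{i\<in>W. g (h i) = g d}"
  have "measure_pmf.prob P {s. noisy x t h d W g (\<lambda>i. \<sigma> i s)} \<le>
      measure_pmf.prob P {s. t \<le> \<bar>\<Sum>i\<in>?A. x i * \<sigma> i s\<bar>}"
    by (intro measure_pmf.finite_measure_mono) (auto simp: noisy_def)
  also have "\<dots> \<le> (\<Sum>i\<in>?A. (x i)\<^sup>2) / t\<^sup>2"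
    using W t by (intro sign_sum_chebyshev[OF \<sigma>]) auto
  also have "\<dots> = (\<Sum>i\<in>?A. noise_weight x t h d i)"
    unfolding sum_divide_distrib using False
    by (intro sum.cong refl) (auto simp: noise_weight_def power_divide)
  also have "\<dots> = noise_bound x t h d W g"
    unfolding noise_bound_def sum.inter_filter[OF W(1)] by (rule sum.cong) simp_all
  finally show ?thesis .
qed

text \<open>Coordinates of bucket \<open>d\<close> collide with probability 1 and contribute at most
  1/32 by \<open>own\<close>; all others collide with probability \<open>1 / G\<close> and
  contribute at most \<open>t powr (- p) / G\<close>, that is 3/32.\<close>

lemma expectation_noise_bound:
  assumes law: "map_pmf X P = pmf_of_set ({1..D} \<rightarrow>\<^sub>E {1..G})" and G: "0 < G"
    and h: "h ` W \<subseteq> {1..D}" and d: "d \<in> {1..D}"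
    and W: "finite W" and t: "0 < t" and p: "0 \<le> p" "p \<le> 2"
    and own: "(\<Sum>i\<in>{i\<in>W. h i = d}. (x i)\<^sup>2) \<le> t\<^sup>2 / 32"
    and other: "(\<Sum>i\<in>W. \<bar>x i\<bar> powr p) \<le> 1" and Gt: "t powr (- p) / G \<le> 3 / 32"
  shows "integrable (measure_pmf P) (\<lambda>s. noise_bound x t h d W (X s))"
    and "measure_pmf.expectation P (\<lambda>s. noise_bound x t h d W (X s)) \<le> 1 / 8"
proof -
  have fin: "finite (set_pmf (map_pmf X P))"
    unfolding law using G by (subst set_pmf_of_set) (auto simp: PiE_eq_empty_iff intro: finite_PiE)
  have int: "integrable (measure_pmf P) (\<lambda>s. F (X s))" for F :: "_ \<Rightarrow> real"
    using integrable_measure_pmf_finite[OF fin, of F] by simp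
  show "integrable (measure_pmf P) (\<lambda>s. noise_bound x t h d W (X s))" by (rule int)
  have coll: "measure_pmf.expectation P (\<lambda>s. of_bool (X s (h i) = X s d)) = (if h i = d then 1 else 1 / G)"
    if "i \<in> W" for i
  proof -
    have "measure_pmf.expectation P (\<lambda>s. of_bool (X s (h i) = X s d) :: real) =
        measure_pmf.expectation P (indicator {s. X s (h i) = X s d})"
      by (intro Bochner_Integration.integral_cong) (auto simp: indicator_def)
    also have "\<dots> = measure_pmf.prob P {s. X s (h i) = X s d}" by simp
    finally show ?thesis
      using random_vector_collision[OF law, of "h i" d] that G d h by auto
  qed
  have "measure_pmf.expectation P (\<lambda>s. noise_bound x t h d W (X s)) =
      (\<Sum>i\<in>W. noise_weight x t h d i * measure_pmf.expectation P (\<lambda>s. of_bool (X s (h i) = X s d)))"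
    unfolding noise_bound_def
    by (subst Bochner_Integration.integral_sum) (auto intro: int[of "\<lambda>g. of_bool (g (h _) = g d)"])
  also have "\<dots> = (\<Sum>i\<in>W. noise_weight x t h d i * (if h i = d then 1 else 1 / G))"
    by (intro sum.cong refl) (simp add: coll)
  also have "\<dots> \<le> (\<Sum>i\<in>W. (if h i = d then (x i)\<^sup>2 / t\<^sup>2 else 0) + (\<bar>x i\<bar> / t) powr p / G)"
  proof (rule sum_mono)
    fix i assume "i \<in> W"
    \<comment> \<open>For \<open>u \<ge> 0\<close> and \<open>0 \<le> p \<le> 2\<close> the minimum
      of 1 and \<open>u^2\<close> is at most \<open>u powr p\<close>; here
      \<open>u = \<bar>x i\<bar> / t\<close>.\<close>
    have "noise_weight x t h d i \<le> (\<bar>x i\<bar> / t) powr p" if "h i \<noteq> d"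
      using that t p square_le_powr[of "\<bar>x i\<bar> / t" p] ge_one_powr_ge_zero[of "\<bar>x i\<bar> / t" p]
      by (auto simp: noise_weight_def power_divide)
    then have "noise_weight x t h d i / G \<le> (\<bar>x i\<bar> / t) powr p / G" if "h i \<noteq> d"
      using that by (intro divide_right_mono) auto
    then show "noise_weight x t h d i * (if h i = d then 1 else 1 / G) \<le>
        (if h i = d then (x i)\<^sup>2 / t\<^sup>2 else 0) + (\<bar>x i\<bar> / t) powr p / G"
      by (auto simp: noise_weight_def power_divide)
  qed
  also have "\<dots> = (\<Sum>i\<in>{i\<in>W. h i = d}. (x i)\<^sup>2) / t\<^sup>2 + t powr (- p) / G * (\<Sum>i\<in>W. \<bar>x i\<bar> powr p)"
    using W t by (simp add: sum.distrib sum.inter_filter sum_divide_distrib sum_distrib_left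
        powr_divide powr_minus if_distrib[of "\<lambda>u. u / _"] field_simps cong: if_cong)
  also have "\<dots> \<le> 1 / 32 + 3 / 32 * 1"
    using own other Gt t by (intro add_mono mult_mono) (auto simp: divide_simps sum_nonneg)
  finally show "measure_pmf.expectation P (\<lambda>s. noise_bound x t h d W (X s)) \<le> 1 / 8" by simp
qed

text \<open>Independence is used three times. With the hash vectors frozen, the sign rows of
  different repetitions are independent, which gives a product of noise bounds; freezing is possible
  since hashes and signs are independent; and the expectation of the product factors because the
  hash vectors are independent.\<close>

lemma prob_all_noisy_le:
  assumes law: "bucket_select_law m D R G P" and G: "0 < G"
    and T: "T \<subseteq> {1..R}" and h: "h ` W \<subseteq> {1..D}" and d: "d \<in> {1..D}"
    and W: "W \<subseteq> {1..m}" and t: "0 < t" and p: "0 \<le> p" "p \<le> 2"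
    and own: "(\<Sum>i\<in>{i\<in>W. h i = d}. (x i)\<^sup>2) \<le> t\<^sup>2 / 32"
    and other: "(\<Sum>i\<in>W. \<bar>x i\<bar> powr p) \<le> 1" and Gt: "t powr (- p) / G \<le> 3 / 32"
  shows "measure_pmf.prob P {s. \<forall>r\<in>T. noisy x t h d W (sel_hashes D R s r) (sel_signs m R s r)}
           \<le> (1 / 8) ^ card T"
proof -
  let ?f = "noise_bound x t h d W"
  let ?X = "\<lambda>r s. \<lambda>d\<in>{1..D}. sel_hash s r d"
  have finW: "finite W" and finT: "finite T" using W T finite_subset by auto
  have hash: "indep_unif P {1..R} ({1..D} \<rightarrow>\<^sub>E {1..G}) ?X"
    and sign: "indep_unif P ({1..R} \<times> {1..m}) {-1, 1} (\<lambda>(r, i) s. sel_sign s r i)"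
    and ind: "indep_rv P (sel_hashes D R) (sel_signs m R)"
    using law by (auto simp: bucket_select_law_def)
  note X = expectation_noise_bound[OF _ G h d finW t p own other Gt]
  have Xlaw: "map_pmf (?X r) P = pmf_of_set ({1..D} \<rightarrow>\<^sub>E {1..G})" if "r \<in> T" for r
    using hash T that by (auto simp: indep_unif_def)
  have hashes: "sel_hashes D R s r = ?X r s" if "r \<in> T" for s r
    using that T by (auto simp: sel_hashes_def)
  have signs: "sel_signs m R s r = (\<lambda>i\<in>{1..m}. sel_sign s r i)" if "r \<in> T" for s r
    using that T by (auto simp: sel_signs_def)
  have pair: "pairwise_indep_unif P {1..m} {-1, 1} (\<lambda>i s. sel_sign s r i)" if "r \<in> T" for r
    using indep_unif_imp_pairwise[OF sign] that T unfolding pairwise_indep_unif_def by fastforce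
  have iv: "prob_space.indep_vars (measure_pmf P) (\<lambda>_. count_space UNIV) ?X T"
    using hash T by (auto simp: indep_unif_def intro: prob_space.indep_vars_subset[OF prob_space_measure_pmf])
  have iv_sign: "prob_space.indep_vars (measure_pmf P) (\<lambda>_. count_space UNIV)
      (\<lambda>(r, i). (\<lambda>r i s. sel_sign s r i) r i) (T \<times> {1..m})"
    using sign T
    by (auto simp: indep_unif_def case_prod_unfold intro: prob_space.indep_vars_subset[OF prob_space_measure_pmf])
  have iv_f: "prob_space.indep_vars (measure_pmf P) (\<lambda>_. borel) (\<lambda>r s. ?f (?X r s)) T"
    by (rule prob_space.indep_vars_compose2[OF prob_space_measure_pmf iv]) simp
  have prods: "measure_pmf.expectation P (\<lambda>s. \<Prod>r\<in>T. ?f (?X r s)) =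
      (\<Prod>r\<in>T. measure_pmf.expectation P (\<lambda>s. ?f (?X r s)))"
    by (rule prob_space.indep_vars_lebesgue_integral[OF prob_space_measure_pmf finT iv_f X(1)[OF Xlaw]])
  have "measure_pmf.prob P {s. \<forall>r\<in>T. noisy x t h d W (sel_hashes D R s r) (sel_signs m R s r)} \<le>
      measure_pmf.expectation P (\<lambda>s. \<Prod>r\<in>T. ?f (sel_hashes D R s r))"
  proof (rule indep_rv_prob_le[OF ind, where f = "\<lambda>\<eta>. \<Prod>r\<in>T. ?f (\<eta> r)"
        and Q = "\<lambda>\<eta> \<tau>. \<forall>r\<in>T. noisy x t h d W (\<eta> r) (\<tau> r)"])
    show "integrable (measure_pmf P) (\<lambda>s. \<Prod>r\<in>T. ?f (sel_hashes D R s r))"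
      using prob_space.indep_vars_integrable[OF prob_space_measure_pmf finT iv_f X(1)[OF Xlaw]]
      by (simp add: hashes cong: prod.cong)
  next
    fix \<eta> :: "nat \<Rightarrow> nat \<Rightarrow> nat"
    have "measure_pmf.prob P {s. \<forall>r\<in>T. noisy x t h d W (\<eta> r) (sel_signs m R s r)} =
        measure_pmf.prob P {s. \<forall>r\<in>T. (\<lambda>i\<in>{1..m}. sel_sign s r i) \<in> {\<tau>. noisy x t h d W (\<eta> r) \<tau>}}"
      by (simp add: signs cong: ball_cong)
    also have "\<dots> = (\<Prod>r\<in>T. measure_pmf.prob P {s. (\<lambda>i\<in>{1..m}. sel_sign s r i) \<in> {\<tau>. noisy x t h d W (\<eta> r) \<tau>}})"
      by (rule indep_vars_rows_prob_all[OF iv_sign finT]) simp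
    also have "\<dots> \<le> (\<Prod>r\<in>T. ?f (\<eta> r))"
    proof (rule prod_mono, intro conjI)
      fix r assume r: "r \<in> T"
      have "noisy x t h d W (\<eta> r) (\<lambda>i\<in>{1..m}. sel_sign s r i) = noisy x t h d W (\<eta> r) (\<lambda>i. sel_sign s r i)" for s :: seed
        unfolding noisy_def using W by (auto simp: subset_iff intro!: sum.cong arg_cong[of _ _ abs])
      then show "measure_pmf.prob P {s. (\<lambda>i\<in>{1..m}. sel_sign s r i) \<in> {\<tau>. noisy x t h d W (\<eta> r) \<tau>}} \<le> ?f (\<eta> r)"
        using prob_noisy_le[OF pair[OF r] finW W t] by (simp only: mem_Collect_eq)
    qed simp
    finally show "measure_pmf.prob P {s. \<forall>r\<in>T. noisy x t h d W (\<eta> r) (sel_signs m R s r)} \<le> (\<Prod>r\<in>T. ?f (\<eta> r))" .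
  qed
  also have "\<dots> = (\<Prod>r\<in>T. measure_pmf.expectation P (\<lambda>s. ?f (?X r s)))"
    unfolding prods[symmetric] by (simp add: hashes cong: prod.cong)
  also have "\<dots> \<le> (\<Prod>r\<in>T. 1 / 8)"
    using X(2)[OF Xlaw] by (intro prod_mono conjI Bochner_Integration.integral_nonneg noise_bound_nonneg)
  finally show ?thesis by simp
qed

text \<open>If \<open>d\<close> were left out, the \<open>k\<close> selected indices would all have
  values at least \<open>Z d > t\<close>. Together with \<open>d\<close> they would be
  \<open>k + 1\<close> elements of \<open>L\<close>.\<close>

lemma selection_rule_superset:
  assumes sel: "selection_rule D k sel" and L: "card L \<le> k" "L \<subseteq> {1..D}"
    and light: "\<And>d. d \<in> {1..D} - L \<Longrightarrow> Z d \<le> t" and d: "d \<in> {1..D}" "t < Z d"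
  shows "d \<in> sel Z"
proof (rule ccontr)
  assume nd: "d \<notin> sel Z"
  have s: "sel Z \<subseteq> {1..D}" "card (sel Z) = k" "\<And>d'. d' \<in> sel Z \<Longrightarrow> Z d \<le> Z d'"
    using sel d nd by (auto simp: selection_rule_def)
  have "insert d (sel Z) \<subseteq> L" using s d light by fastforce
  then have "card (insert d (sel Z)) \<le> card L" using L finite_subset by (intro card_mono) auto
  then show False using nd s L finite_subset[OF s(1)] by simp
qed

text \<open>With \<open>R = 2 * n - 1\<close> repetitions a median can mislead only if
  \<open>n\<close> of them are noisy. Bounding the binomial coefficient by \<open>2 ^ R\<close>,
  this has probability at most \<open>2 ^ R / 8 ^ n\<close> for each bucket, and a union bound over
  the \<open>D\<close> buckets follows.\<close>

lemma prob_selection_failure: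
  assumes law: "bucket_select_law m D R G P" and sel: "selection_rule D k sel"
    and G: "0 < G" and R: "R = 2 * n - 1" "0 < n" and h: "h ` {1..m} \<subseteq> {1..D}"
    and t: "0 < t" and p: "0 \<le> p" "p \<le> 2" and x: "(\<Sum>i\<in>{1..m}. \<bar>x i\<bar> powr p) \<le> 1"
    and Gt: "t powr (- p) / G \<le> 3 / 32" and k: "(t / sqrt 32) powr (- p) < k + 1"
    and Hv: "Hv \<subseteq> {1..m}" "\<And>i. i \<in> Hv \<Longrightarrow> 2 * t < \<bar>x i\<bar>"
      "\<And>i. i \<in> Hv \<Longrightarrow> (\<Sum>j\<in>{j\<in>{1..m} - {i}. h j = h i}. (x j)\<^sup>2) \<le> t\<^sup>2 / 32"
  shows "measure_pmf.prob P {s. \<exists>i\<in>Hv. h i \<notin>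
      sel (\<lambda>d\<in>{1..D}. bucket_stat m x D R G h (sel_hashes D R s) (sel_signs m R s) d)} \<le> D * 2 ^ R / 8 ^ n"
proof -
  define v where "v d = (\<Sum>i\<in>{i\<in>{1..m}. h i = d}. (x i)\<^sup>2)" for d
  define top where "top d = (SOME i. i \<in> Hv \<and> h i = d)" for d
  \<comment> \<open>The noise of a bucket depends on its role: everything but one heavy coordinate
    for a heavy bucket, everything for a light one. A bucket with large mass but no heavy coordinate
    may be selected or not; its noise set is empty, so it never counts as failing.\<close>
  define W where "W d = (if d \<in> h ` Hv then {1..m} - {top d} else if v d \<le> t\<^sup>2 / 32 then {1..m} else {})" for d
  define fails where "fails d s \<longleftrightarrow>
      n \<le> card {r \<in> {1..R}. noisy x t h d (W d) (sel_hashes D R s r) (sel_signs m R s r)}" for d s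
  define L where "L = {d \<in> {1..D}. t\<^sup>2 / 32 < v d}"
  let ?Z = "\<lambda>s d. bucket_stat m x D R G h (sel_hashes D R s) (sel_signs m R s) d"

  have top: "top d \<in> Hv" "h (top d) = d" if "d \<in> h ` Hv" for d
    using someI_ex[of "\<lambda>i. i \<in> Hv \<and> h i = d"] that unfolding top_def by blast+

  \<comment> \<open>After scaling by \<open>t / sqrt 32\<close>, every bucket in \<open>L\<close>
    has a sum of \<open>p\<close>-th powers of at least 1, while the total over all buckets is below
    \<open>k + 1\<close>.\<close>
  have card_L: "card L \<le> k"
  proof -
    have "real (card L) = (\<Sum>d\<in>L. 1)" by simp
    also have "\<dots> \<le> (\<Sum>d\<in>L. \<Sum>i\<in>{i\<in>{1..m}. h i = d}. (\<bar>x i\<bar> / (t / sqrt 32)) powr p)"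
    proof (rule sum_mono)
      fix d assume "d \<in> L"
      then have "(t / sqrt 32)\<^sup>2 < (\<Sum>i\<in>{i\<in>{1..m}. h i = d}. (x i)\<^sup>2)"
        by (simp add: L_def v_def power_divide)
      then show "1 \<le> (\<Sum>i\<in>{i\<in>{1..m}. h i = d}. (\<bar>x i\<bar> / (t / sqrt 32)) powr p)"
        using t p by (intro sum_powr_ge_one) auto
    qed
    also have "\<dots> \<le> (\<Sum>d\<in>{1..D}. \<Sum>i\<in>{i\<in>{1..m}. h i = d}. (\<bar>x i\<bar> / (t / sqrt 32)) powr p)"
      by (intro sum_mono2) (auto simp: L_def intro!: sum_nonneg)
    also have "\<dots> = (\<Sum>i\<in>{1..m}. (\<bar>x i\<bar> / (t / sqrt 32)) powr p)"
      using h by (intro sum.group) auto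
    also have "\<dots> = (t / sqrt 32) powr (- p) * (\<Sum>i\<in>{1..m}. \<bar>x i\<bar> powr p)"
      using t unfolding sum_distrib_left by (intro sum.cong refl) (simp add: powr_divide powr_minus powr_mult field_simps)
    also have "\<dots> \<le> (t / sqrt 32) powr (- p) * 1" using x by (intro mult_left_mono) auto
    finally show ?thesis using k by linarith
  qed

  have fail_prob: "measure_pmf.prob P {s. fails d s} \<le> 2 ^ R / 8 ^ n" if d: "d \<in> {1..D}" for d
  proof -
    have sub: "W d \<subseteq> {1..m}" by (auto simp: W_def)
    have own: "(\<Sum>i\<in>{i\<in>W d. h i = d}. (x i)\<^sup>2) \<le> t\<^sup>2 / 32"
      using Hv(3)[OF top(1)] top(2) t by (auto simp: W_def v_def)
    have other: "(\<Sum>i\<in>W d. \<bar>x i\<bar> powr p) \<le> 1"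
      using sub by (intro order_trans[OF sum_mono2 x]) auto
    have "measure_pmf.prob P {s. fails d s} \<le> real (card {1..R} choose n) * (1 / 8) ^ n"
      unfolding fails_def using prob_all_noisy_le[OF law G _ _ d sub t p own other Gt] sub h
      by (intro prob_many_failures) auto
    also have "\<dots> \<le> 2 ^ R * (1 / 8) ^ n"
      using of_nat_mono[OF binomial_le_pow2[of R n], where 'a = real] by (intro mult_right_mono) simp_all
    finally show ?thesis by (simp add: power_divide)
  qed

  have good: "h i \<in> sel (\<lambda>d\<in>{1..D}. ?Z s d)"
    if s: "s \<in> set_pmf P" and nf: "\<And>d. d \<in> {1..D} \<Longrightarrow> \<not> fails d s" and i: "i \<in> Hv" for s i
  proof -
    let ?H = "sel_hashes D R s" and ?\<sigma> = "sel_signs m R s"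
    define y where "y d r = (\<Sum>i\<in>{i\<in>{1..m}. ?H r (h i) = ?H r d}. x i * ?\<sigma> r i)" for d r
    have range: "?H r d \<in> {1..G}" if "r \<in> {1..R}" "d \<in> {1..D}" for r d
    proof -
      have "map_pmf (\<lambda>s. \<lambda>d\<in>{1..D}. sel_hash s r d) P = pmf_of_set ({1..D} \<rightarrow>\<^sub>E {1..G})"
        using law that by (auto simp: bucket_select_law_def indep_unif_def)
      from arg_cong[OF this, of set_pmf]
      have img: "(\<lambda>s. \<lambda>d\<in>{1..D}. sel_hash s r d) ` set_pmf P = {1..D} \<rightarrow>\<^sub>E {1..G}"
        using G by (subst (asm) set_pmf_of_set) (auto simp: PiE_eq_empty_iff intro: finite_PiE)
      have "(\<lambda>d\<in>{1..D}. sel_hash s r d) \<in> {1..D} \<rightarrow>\<^sub>E {1..G}"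
        using imageI[OF s] unfolding img[symmetric] .
      then show ?thesis using that by (auto simp: sel_hashes_def PiE_iff)
    qed
    have sgn: "\<bar>?\<sigma> r i\<bar> = 1" if "r \<in> {1..R}" "i \<in> {1..m}" for r i
    proof -
      have "indep_unif P ({1..R} \<times> {1..m}) {-1, 1} (\<lambda>(r, i) s. sel_sign s r i)"
        using law by (simp add: bucket_select_law_def)
      from pairwise_indep_unif_in[OF indep_unif_imp_pairwise[OF this], of "(r, i)" s] that s
      show ?thesis by (auto simp: sel_signs_def)
    qed
    have Z: "?Z s d = median (map (\<lambda>r. \<bar>y d r\<bar>) [1..<Suc R])" if "d \<in> {1..D}" for d
    proof -
      have "{i \<in> {1..m}. h i \<in> {1..D} \<and> ?H r (h i) = ?H r d} = {i \<in> {1..m}. ?H r (h i) = ?H r d}" for r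
        using h by blast
      then show ?thesis unfolding bucket_stat_def y_def using range that
        by (intro arg_cong[of _ _ median] map_cong refl) (simp del: upt_Suc)
    qed
    have len: "length (map f [1..<Suc R]) div 2 = n - 1" "odd (length (map f [1..<Suc R]))"
      "map f [1..<Suc R] \<noteq> []" for f :: "nat \<Rightarrow> real"
      using R by auto
    have few: "card {r \<in> {1..R}. noisy x t h d (W d) (?H r) (?\<sigma> r)} < n" if "d \<in> {1..D}" for d
      using nf[OF that] by (simp add: fails_def)
    \<comment> \<open>If the median is at most \<open>t\<close>, so are \<open>n\<close> of the
      measurements. Each contains a signal above \<open>2 * t\<close>, so the rest of it exceeds
      \<open>t\<close> and the repetition is noisy.\<close>
    have heavy: "t < ?Z s d" if d: "d \<in> h ` Hv" for d
    proof (rule ccontr)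
      assume "\<not> t < ?Z s d"
      moreover have dD: "d \<in> {1..D}" using d h Hv(1) by blast
      ultimately have "n \<le> card {r \<in> {1..R}. \<bar>y d r\<bar> \<le> t}"
        using median_le_imp_many[of "map (\<lambda>r. \<bar>y d r\<bar>) [1..<Suc R]" t] len Z[OF dD]
        unfolding length_filter_upt by simp
      also have "\<dots> \<le> card {r \<in> {1..R}. noisy x t h d (W d) (?H r) (?\<sigma> r)}"
      proof (intro card_mono subsetI CollectI conjI; (elim CollectE conjE)?)
        fix r assume r: "r \<in> {1..R}" "\<bar>y d r\<bar> \<le> t"
        have tm: "top d \<in> {1..m}" using top(1)[OF d] Hv(1) by blast
        have "y d r = x (top d) * ?\<sigma> r (top d) + (\<Sum>i\<in>{i\<in>{1..m}. ?H r (h i) = ?H r d} - {top d}. x i * ?\<sigma> r i)"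
          unfolding y_def using tm top(2)[OF d] by (intro sum.remove) auto
        moreover have "{i\<in>{1..m}. ?H r (h i) = ?H r d} - {top d} = {i\<in>W d. ?H r (h i) = ?H r d}"
          using d by (auto simp: W_def)
        moreover have "2 * t < \<bar>x (top d) * ?\<sigma> r (top d)\<bar>"
          using Hv(2)[OF top(1)[OF d]] sgn[OF r(1) tm] by (simp add: abs_mult)
        ultimately show "noisy x t h d (W d) (?H r) (?\<sigma> r)" using r(2) by (simp add: noisy_def)
      qed auto
      also have "\<dots> < n" by (rule few[OF dD])
      finally show False by simp
    qed
    \<comment> \<open>A bucket outside \<open>L\<close> contains no heavy coordinate, as that alone
      would bring \<open>(2 * t)^2\<close> to its mass. Its measurements are therefore pure noise,
      and a median above \<open>t\<close> makes \<open>n\<close> repetitions noisy.\<close>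
    have light: "?Z s d \<le> t" if d: "d \<in> {1..D} - L" for d
    proof (rule ccontr)
      assume gt: "\<not> ?Z s d \<le> t"
      have nh: "d \<notin> h ` Hv"
      proof
        assume dh: "d \<in> h ` Hv"
        have "t\<^sup>2 / 32 < (2 * t)\<^sup>2" using t by (simp add: power_mult_distrib)
        also have "\<dots> \<le> (x (top d))\<^sup>2"
          using power_mono[of "2 * t" "\<bar>x (top d)\<bar>" 2] Hv(2)[OF top(1)[OF dh]] t by simp
        also have "\<dots> \<le> v d"
          unfolding v_def using top[OF dh] Hv(1) by (intro member_le_sum) auto
        finally show False using d by (auto simp: L_def)
      qed
      have W: "W d = {1..m}" using nh d by (auto simp: W_def L_def)
      have dD: "d \<in> {1..D}" using d by simp
      have "n \<le> card {r \<in> {1..R}. t < \<bar>y d r\<bar>}"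
        using median_gt_imp_many[of t "map (\<lambda>r. \<bar>y d r\<bar>) [1..<Suc R]"] len Z[OF dD] gt
        unfolding length_filter_upt by simp
      also have "{r \<in> {1..R}. t < \<bar>y d r\<bar>} = {r \<in> {1..R}. noisy x t h d (W d) (?H r) (?\<sigma> r)}"
        by (simp add: noisy_def y_def W)
      also have "card \<dots> < n" by (rule few[OF dD])
      finally show False by simp
    qed
    have "h i \<in> {1..D}" using i h Hv(1) by blast
    then show ?thesis
      using heavy light i card_L by (intro selection_rule_superset[OF sel card_L, of _ t]) (auto simp: L_def)
  qed

  \<comment> \<open>Hash values are in range and signs have modulus 1 only on the support, so the
    event is intersected with it before \<open>good\<close> is applied.\<close>
  have "measure_pmf.prob P {s. \<exists>i\<in>Hv. h i \<notin> sel (\<lambda>d\<in>{1..D}. ?Z s d)}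
      = measure_pmf.prob P ({s. \<exists>i\<in>Hv. h i \<notin> sel (\<lambda>d\<in>{1..D}. ?Z s d)} \<inter> set_pmf P)"
    by (simp only: measure_Int_set_pmf)
  also have "\<dots> \<le> measure_pmf.prob P (\<Union>d\<in>{1..D}. {s. fails d s})"
  proof (intro measure_pmf.finite_measure_mono subsetI; (elim IntE CollectE bexE)?)
    fix s i assume s: "s \<in> set_pmf P" "i \<in> Hv" "h i \<notin> sel (\<lambda>d\<in>{1..D}. ?Z s d)"
    show "s \<in> (\<Union>d\<in>{1..D}. {s. fails d s})"
    proof (rule ccontr)
      assume "s \<notin> (\<Union>d\<in>{1..D}. {s. fails d s})"
      then have "\<not> fails d s" if "d \<in> {1..D}" for d using that by blast
      from good[OF s(1) this s(2)] s(3) show False by blast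
    qed
  qed simp
  also have "\<dots> \<le> (\<Sum>d\<in>{1..D}. measure_pmf.prob P {s. fails d s})"
    by (intro measure_pmf.finite_measure_subadditive_finite) auto
  also have "\<dots> \<le> (\<Sum>d\<in>{1..D}. 2 ^ R / 8 ^ n)" by (intro sum_mono fail_prob)
  finally show ?thesis by simp
qed

section \<open>Spotting the heavy coordinate of a bucket\<close>

lemma expectation_sum_of_bool:
  fixes c :: "'i \<Rightarrow> real"
  shows "integrable (measure_pmf P) (\<lambda>s. \<Sum>j\<in>A. c j * of_bool (Q j s))"
    and "measure_pmf.expectation P (\<lambda>s. \<Sum>j\<in>A. c j * of_bool (Q j s)) =
      (\<Sum>j\<in>A. c j * measure_pmf.prob P {s. Q j s})"
proof -
  have eq: "(of_bool (Q j s) :: real) = indicator {s. Q j s} s" for j s by (simp add: indicator_def)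
  have int: "integrable (measure_pmf P) (\<lambda>s. c j * indicator {s. Q j s} s)" for j
    by (intro integrable_mult_right integrable_real_indicator) (auto simp: measure_pmf.emeasure_eq_measure)
  show "integrable (measure_pmf P) (\<lambda>s. \<Sum>j\<in>A. c j * of_bool (Q j s))"
    unfolding eq by (intro Bochner_Integration.integrable_sum int)
  show "measure_pmf.expectation P (\<lambda>s. \<Sum>j\<in>A. c j * of_bool (Q j s)) =
      (\<Sum>j\<in>A. c j * measure_pmf.prob P {s. Q j s})"
    unfolding eq by (subst Bochner_Integration.integral_sum[OF int]) simp
qed

lemma run_shrink_cong:
  assumes "\<And>j. j \<in> S \<Longrightarrow> h j = h' j" "\<And>j. j \<in> S \<Longrightarrow> \<sigma> j = \<sigma>' j"
  shows "run m x (shrink D0 h \<sigma> S) = run m x (shrink D0 h' \<sigma>' S)"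
  using assms by (simp add: shrink_def cong: if_cong conj_cong)

lemma run_spot_from_cong:
  assumes "\<And>l j. l < ks \<Longrightarrow> j \<in> S \<Longrightarrow> H l j = H' l j" "\<And>l j. l \<le> ks \<Longrightarrow> j \<in> S \<Longrightarrow> \<sigma> l j = \<sigma>' l j" "k \<le> ks"
  shows "run m x (spot_from ks \<alpha> e H \<sigma> k S) = run m x (spot_from ks \<alpha> e H' \<sigma>' k S)"
  using assms
proof (induction ks \<alpha> e H \<sigma> k S rule: spot_from.induct)
  case (1 ks \<alpha> e H \<sigma> k S)
  consider "card S \<le> 1" | "\<not> card S \<le> 1" "k < ks" | "\<not> card S \<le> 1" "\<not> k < ks" by blast
  then show ?case
  proof cases
    case 1
    then show ?thesis by (simp add: spot_from.simps[of ks])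
  next
    case 2
    let ?S = "run m x (shrink (spot_D \<alpha> k) (H k) (\<sigma> k) S)"
    have eq: "run m x (shrink (spot_D \<alpha> k) (H' k) (\<sigma>' k) S) = ?S"
      using 2 "1.prems" by (intro run_shrink_cong) auto
    have S: "j \<in> S" if "j \<in> ?S" for j
      using that run_shrink_subset by blast
    have "run m x (spot_from ks \<alpha> e H \<sigma> (Suc k) ?S) = run m x (spot_from ks \<alpha> e H' \<sigma>' (Suc k) ?S)"
      using 2 by (intro "1.IH"[OF 2] "1.prems" S) simp_all
    then show ?thesis using 2 by (simp add: spot_from.simps[of ks _ _ _ _ k S] eq)
  next
    case 3
    then have "run m x (shrink (card S) (e S) (\<sigma> k) S) = run m x (shrink (card S) (e S) (\<sigma>' k) S)"
      using "1.prems" by (intro run_shrink_cong) simp_all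
    then show ?thesis using 3 by (simp add: spot_from.simps[of ks _ _ _ _ k S])
  qed
qed

text \<open>Spot reads hash values and signs only at indices in \<open>J\<close> and at the steps it
  performs. It can thus be run on the restricted functions, for which the seed law provides
  independence.\<close>

lemma run_spot_restrict:
  assumes "J \<subseteq> {1..m}"
  shows "run m x (spot m \<alpha> e (spot_hash s d) (spot_sign s d) J) =
    run m x (spot m \<alpha> e (spot_hashes m d s) (spot_signs m d s) J)"
  unfolding spot_def using assms
  by (intro run_spot_from_cong) (auto simp: spot_hashes_def spot_signs_def subset_iff)

section \<open>Growth of the hash ranges in Spot\<close>

definition spot_E :: "real \<Rightarrow> nat \<Rightarrow> real" where
  "spot_E \<alpha> k = 2 powr (8 * (9/8) ^ k + real k + 2) / \<alpha>"

context
  fixes \<alpha> :: real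
  assumes \<alpha>: "0 < \<alpha>" "\<alpha> < 1"
begin

lemma spot_E_ge: "1024 \<le> spot_E \<alpha> k"
proof -
  have "(2::real) powr 10 \<le> 2 powr (8 * (9/8) ^ k + real k + 2)"
    using one_le_power[of "9/8 :: real" k] by (intro powr_mono) (simp_all del: one_le_power)
  also have "\<dots> \<le> spot_E \<alpha> k" using \<alpha> by (simp add: spot_E_def divide_simps)
  finally show ?thesis by simp
qed

lemma spot_D_bounds: "spot_E \<alpha> k \<le> spot_D \<alpha> k" "real (spot_D \<alpha> k) \<le> spot_E \<alpha> k + 1"
proof -
  have "spot_D \<alpha> k = nat \<lceil>spot_E \<alpha> k\<rceil>" by (simp add: spot_D_def spot_E_def)
  then show "spot_E \<alpha> k \<le> spot_D \<alpha> k" "real (spot_D \<alpha> k) \<le> spot_E \<alpha> k + 1"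
    using spot_E_ge[of k] by linarith+
qed

lemma spot_D_pos: "0 < spot_D \<alpha> k"
  using spot_D_bounds(1)[of k] spot_E_ge[of k] by linarith

text \<open>With \<open>q = (9/8) ^ k\<close> the exponents of 2 are
  \<open>2 * (9 * q + k + 3)\<close> and \<open>3 * (8 * q + k + 2)\<close>. The surplus
  \<open>6 * q + k \<ge> 6\<close> pays for the factor 64, and the spare factor
  \<open>1 / \<alpha>\<close> exceeds 1.\<close>

lemma spot_E_Suc: "64 * (spot_E \<alpha> (Suc k))\<^sup>2 \<le> spot_E \<alpha> k ^ 3"
proof -
  define q where "q = (9/8 :: real) ^ k"
  have q: "1 \<le> q" by (simp add: q_def)
  have sq: "(2 powr a)\<^sup>2 = 2 powr (2 * a)" "(2 powr a) ^ 3 = 2 powr (3 * a)" for a :: real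
    by (simp_all add: powr_power mult.commute)
  have "64 * \<alpha> * 2 powr (2 * (9 * q + real (Suc k) + 2)) \<le> 2 powr 6 * 1 * 2 powr (2 * (9 * q + real (Suc k) + 2))"
    using \<alpha> by (intro mult_mono) auto
  also have "\<dots> = 2 powr (6 + 2 * (9 * q + real (Suc k) + 2))" by (simp only: powr_add mult_1_right)
  also have "\<dots> \<le> 2 powr (3 * (8 * q + real k + 2))" using q by (intro powr_mono) auto
  finally have "64 * \<alpha> * 2 powr (2 * (9 * q + real (Suc k) + 2)) \<le> 2 powr (3 * (8 * q + real k + 2))" .
  then have "64 * (2 powr (2 * (9 * q + real (Suc k) + 2)) / \<alpha>\<^sup>2) \<le> 2 powr (3 * (8 * q + real k + 2)) / \<alpha> ^ 3"
    using \<alpha> by (simp add: divide_simps power2_eq_square power3_eq_cube mult.commute mult.left_commute)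
  then show ?thesis by (simp add: spot_E_def power_divide sq q_def)
qed

text \<open>The numerator bounds the squared hash differences in the second functional of step
  \<open>k\<close>; the reciprocal of the product is the probability that a given other coordinate
  is still present then.\<close>

definition spot_var :: "nat \<Rightarrow> real" where
  "spot_var k = (real (spot_D \<alpha> k))\<^sup>2 / (\<Prod>l<k. real (spot_D \<alpha> l))"

text \<open>The ratio of consecutive values is \<open>D_{k+1}^2 / D_k^3\<close>. It is at most 1/16:
  \<open>spot_E_Suc\<close> gives 1/64, and rounding up at most doubles the hash range, which costs
  a factor 4.\<close>

lemma spot_var_bound: "spot_var k \<le> (1025 / \<alpha>)\<^sup>2 * (1 / 16) ^ k"
proof (induction k)
  case 0
  have "real (spot_D \<alpha> 0) \<le> 1024 / \<alpha> + 1" using spot_D_bounds(2)[of 0] by (simp add: spot_E_def)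
  also have "\<dots> \<le> 1025 / \<alpha>" using \<alpha> by (simp add: field_simps)
  finally show ?case by (simp add: spot_var_def power_mono)
next
  case (Suc k)
  let ?D = "\<lambda>k. real (spot_D \<alpha> k)"
  have "?D (Suc k) \<le> 2 * spot_E \<alpha> (Suc k)" using spot_D_bounds(2)[of "Suc k"] spot_E_ge[of "Suc k"] by linarith
  then have "(?D (Suc k))\<^sup>2 \<le> (2 * spot_E \<alpha> (Suc k))\<^sup>2" by (intro power_mono) auto
  then have "16 * (?D (Suc k))\<^sup>2 \<le> 64 * (spot_E \<alpha> (Suc k))\<^sup>2" by (simp add: power_mult_distrib)
  also have "\<dots> \<le> spot_E \<alpha> k ^ 3" by (rule spot_E_Suc)
  also have "\<dots> \<le> ?D k ^ 3" using spot_D_bounds(1)[of k] spot_E_ge[of k] by (intro power_mono) auto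
  finally have le: "16 * (?D (Suc k))\<^sup>2 \<le> ?D k ^ 3" .
  have pos: "0 < ?D k" "0 < (\<Prod>l<k. ?D l)" using spot_D_pos by (auto intro!: prod_pos)
  have "spot_var (Suc k) \<le> (?D k ^ 3 / 16) / ((\<Prod>l<k. ?D l) * ?D k)"
    unfolding spot_var_def prod.lessThan_Suc using le pos by (intro divide_right_mono) auto
  also have "\<dots> = spot_var k / 16"
    using pos by (simp add: spot_var_def power2_eq_square power3_eq_cube)
  also have "\<dots> \<le> (1025 / \<alpha>)\<^sup>2 * (1 / 16) ^ Suc k" using Suc by simp
  finally show ?case .
qed

text \<open>The number of steps is chosen so that \<open>8 * (9/8) ^ spot_kstar m\<close> reaches
  \<open>log 2 m\<close>. Hence the hash values of the final step, at most \<open>m\<close>, obey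
  the same bound as those of a regular step.\<close>

lemma le_spot_D_kstar: "1 \<le> m \<Longrightarrow> m \<le> spot_D \<alpha> (spot_kstar m)"
proof -
  assume m: "1 \<le> m"
  show ?thesis
  proof (cases "m = 1")
    case True then show ?thesis using spot_D_pos[of "spot_kstar m"] by simp
  next
    case False
    define L where "L = log 2 (real m) / 8"
    have L: "0 < L" using m False by (simp add: L_def)
    have "log (9/8) L \<le> spot_kstar m" using False by (simp add: spot_kstar_def L_def, linarith)
    then have "(9/8) powr log (9/8) L \<le> (9/8) powr real (spot_kstar m)" by (intro powr_mono) auto
    then have "L \<le> (9/8) ^ spot_kstar m" using L by (simp add: powr_realpow)
    then have "log 2 (real m) \<le> 8 * (9/8) ^ spot_kstar m + real (spot_kstar m) + 2" by (simp add: L_def)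
    then have "2 powr log 2 (real m) \<le> 2 powr (8 * (9/8) ^ spot_kstar m + real (spot_kstar m) + 2)"
      by (intro powr_mono) auto
    then have "real m \<le> 2 powr (8 * (9/8) ^ spot_kstar m + real (spot_kstar m) + 2)" using m by simp
    also have "\<dots> \<le> spot_E \<alpha> (spot_kstar m)" using \<alpha> by (simp add: spot_E_def divide_simps)
    also note spot_D_bounds(1)
    finally show ?thesis by simp
  qed
qed

text \<open>With the hashes frozen, the signs make step \<open>k\<close> fail with probability at
  most \<open>5 * D_k^2\<close> times the relative \<open>l_2\<close>-mass of \<open>T k\<close>.
  Averaging over the hashes turns membership in \<open>T k\<close> into its probability and yields
  \<open>spot_var k\<close>; a geometric sum over the steps concludes.\<close>

lemma prob_spot_failure:
  assumes law: "spot_law m \<alpha> d P" and e: "enumeration_rule m e"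
    and J: "J \<subseteq> {1..m}" "i \<in> J" and xi: "x i \<noteq> 0"
    and small: "(\<Sum>j\<in>J - {i}. (x j)\<^sup>2) \<le> (x i)\<^sup>2 * (\<alpha> ^ 3 / (2 * 2049\<^sup>2))"
  shows "measure_pmf.prob P {s. i \<notin> run m x (spot m \<alpha> e (spot_hashes m d s) (spot_signs m d s) J)} \<le> \<alpha>"
proof -
  let ?ks = "spot_kstar m" and ?D = "spot_D \<alpha>"
  define T where "T \<eta> k = {j \<in> J. \<forall>l<k. \<eta> l j = \<eta> l i}" for \<eta> :: "nat \<Rightarrow> nat \<Rightarrow> nat" and k
  define g where "g \<eta> k = (if k < ?ks then \<eta> k else e (T \<eta> k))" for \<eta> k
  \<comment> \<open>The exact negation of the condition in \<open>run_shrink\<close>, evaluated on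
    \<open>T \<eta> k\<close>, a set that the hashes alone determine.\<close>
  define bad where "bad k \<eta> \<tau> \<longleftrightarrow> \<bar>x i\<bar> \<le> \<bar>\<Sum>j\<in>T \<eta> k - {i}. x j * \<tau> k j\<bar>
      + 2 * \<bar>\<Sum>j\<in>T \<eta> k - {i}. (real (g \<eta> k j) - real (g \<eta> k i)) * x j * \<tau> k j\<bar>"
    for k \<eta> and \<tau> :: "nat \<Rightarrow> nat \<Rightarrow> real"
  let ?N = "\<Sum>j\<in>J - {i}. (x j)\<^sup>2"
  have finJ: "finite J" using J finite_subset by auto
  have im: "i \<in> {1..m}" "1 \<le> m" using J by auto
  have hash: "\<And>k. k < ?ks \<Longrightarrow> pairwise_indep_unif P {1..m} {1..?D k} (\<lambda>i s. spot_hash s d k i)"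
    and hash_iv: "prob_space.indep_vars (measure_pmf P) (\<lambda>_. count_space UNIV)
       (\<lambda>k s. \<lambda>i\<in>{1..m}. spot_hash s d k i) {..<?ks}"
    and sign: "\<And>k. k \<le> ?ks \<Longrightarrow> pairwise_indep_unif P {1..m} {-1, 1} (\<lambda>i s. spot_sign s d k i)"
    and ind: "indep_rv P (spot_hashes m d) (spot_signs m d)"
    using law by (auto simp: spot_law_def)

  \<comment> \<open>Each step keeps \<open>j\<close> together with \<open>i\<close> with probability
    \<open>1 / ?D l\<close>, and the hash vectors of different steps are independent.\<close>
  have stay: "measure_pmf.prob P {s. j \<in> T (spot_hashes m d s) k} = (\<Prod>l<k. 1 / ?D l)"
    if j: "j \<in> J - {i}" and k: "k \<le> ?ks" for j k
  proof -
    have jm: "j \<in> {1..m}" using j J by auto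
    have iv: "prob_space.indep_vars (measure_pmf P) (\<lambda>_. count_space UNIV)
       (\<lambda>k s. \<lambda>i\<in>{1..m}. spot_hash s d k i) {..<k}"
      using hash_iv k by (auto intro: prob_space.indep_vars_subset[OF prob_space_measure_pmf])
    have "{s. j \<in> T (spot_hashes m d s) k} = {s. \<forall>l\<in>{..<k}. (\<lambda>i\<in>{1..m}. spot_hash s d l i) \<in> {f. f j = f i}}"
      using j k jm im by (auto simp: T_def spot_hashes_def)
    then have "measure_pmf.prob P {s. j \<in> T (spot_hashes m d s) k} =
        (\<Prod>l<k. measure_pmf.prob P {s. (\<lambda>i\<in>{1..m}. spot_hash s d l i) \<in> {f. f j = f i}})"
      using indep_vars_prob_all[OF iv, of "\<lambda>_. {f. f j = f i}"] by simp
    also have "\<dots> = (\<Prod>l<k. 1 / ?D l)"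
    proof (rule prod.cong[OF refl])
      fix l assume "l \<in> {..<k}"
      then show "measure_pmf.prob P {s. (\<lambda>i\<in>{1..m}. spot_hash s d l i) \<in> {f. f j = f i}} = 1 / ?D l"
        using pairwise_indep_unif_collision[OF hash, of l j i] k j jm im spot_D_pos[of l] by simp
    qed
    finally show ?thesis .
  qed

  have step: "measure_pmf.prob P {s. bad k (spot_hashes m d s) (spot_signs m d s)} \<le>
      5 * spot_var k * ?N / (x i)\<^sup>2" if k: "k \<le> ?ks" for k
  proof -
    let ?c = "\<lambda>j. 5 * (real (?D k))\<^sup>2 * (x j)\<^sup>2 / (x i)\<^sup>2"
    let ?f = "\<lambda>\<eta>. \<Sum>j\<in>J - {i}. ?c j * of_bool (j \<in> T \<eta> k)"
    have "measure_pmf.prob P {s. bad k (spot_hashes m d s) (spot_signs m d s)} \<le>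
        measure_pmf.expectation P (\<lambda>s. ?f (spot_hashes m d s))"
    proof (rule indep_rv_prob_le[OF ind, where f = ?f and Q = "bad k"])
      fix \<eta> assume "\<eta> \<in> spot_hashes m d ` set_pmf P"
      then obtain s where s: "s \<in> set_pmf P" "\<eta> = spot_hashes m d s" by blast
      let ?A = "T \<eta> k - {i}"
      have A: "finite ?A" "?A \<subseteq> {1..m}" using finJ J by (auto simp: T_def)
      \<comment> \<open>For a hashing step this is the support of the hash law; for the final step
        it follows from \<open>card (T \<eta> k) \<le> m\<close> and the choice of the number of
        steps.\<close>
      have gD: "g \<eta> k j \<in> {1..?D k}" if "j \<in> T \<eta> k" for j
      proof (cases "k < ?ks")
        case True
        have "j \<in> {1..m}" using that J by (auto simp: T_def)
        then show ?thesis
          using True pairwise_indep_unif_in[OF hash[OF True], of j s] spot_D_pos[of k] s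
          by (auto simp: g_def spot_hashes_def)
      next
        case False
        then have "k = ?ks" using k by simp
        have TJ: "T \<eta> k \<subseteq> {1..m}" using J by (auto simp: T_def)
        then have "e (T \<eta> k) ` T \<eta> k \<subseteq> {1..card (T \<eta> k)}" using e by (auto simp: enumeration_rule_def)
        then have "g \<eta> k j \<in> {1..card (T \<eta> k)}" using that False by (auto simp: g_def)
        moreover have "card (T \<eta> k) \<le> m" using card_mono[OF _ TJ] by simp
        moreover have "m \<le> ?D k" using le_spot_D_kstar[OF im(2)] \<open>k = ?ks\<close> by simp
        ultimately show ?thesis by auto
      qed
      have iT: "i \<in> T \<eta> k" using J by (auto simp: T_def)
      have diff: "\<bar>real (g \<eta> k j) - real (g \<eta> k i)\<bar> \<le> ?D k" if "j \<in> ?A" for j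
        using gD[of j] gD[OF iT] that by auto
      have "18 \<le> real (?D k)" using spot_D_bounds(1)[of k] spot_E_ge[of k] by linarith
      then have M: "18 \<le> (real (?D k))\<^sup>2" using power_mono[of 18 "real (?D k)" 2] by simp
      have "measure_pmf.prob P {s. bad k \<eta> (spot_signs m d s)} =
          measure_pmf.prob P {s. \<bar>x i\<bar> \<le> \<bar>\<Sum>j\<in>?A. x j * spot_sign s d k j\<bar>
            + 2 * \<bar>\<Sum>j\<in>?A. (real (g \<eta> k j) - real (g \<eta> k i)) * x j * spot_sign s d k j\<bar>}"
      proof -
        have "spot_signs m d s k j = spot_sign s d k j" if "j \<in> ?A" for s :: seed and j
          using that A k by (auto simp: spot_signs_def)
        then have "(\<Sum>j\<in>?A. c j * spot_signs m d s k j) = (\<Sum>j\<in>?A. c j * spot_sign s d k j)" for c :: "nat \<Rightarrow> real" and s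
          by (intro sum.cong) auto
        then show ?thesis by (simp only: bad_def)
      qed
      also have "\<dots> \<le> 5 * (real (?D k))\<^sup>2 * (\<Sum>j\<in>?A. (x j)\<^sup>2) / \<bar>x i\<bar>\<^sup>2"
        using sign_sums_tail[where t = "\<bar>x i\<bar>" and c = x, OF sign[OF k] A _ diff M] xi by simp
      also have "(\<Sum>j\<in>?A. (x j)\<^sup>2) = (\<Sum>j\<in>J - {i}. (x j)\<^sup>2 * of_bool (j \<in> T \<eta> k))"
        using finJ by (intro sum.mono_neutral_cong_left) (auto simp: T_def)
      finally show "measure_pmf.prob P {s. bad k \<eta> (spot_signs m d s)} \<le> ?f \<eta>"
        by (simp add: sum_distrib_left sum_divide_distrib mult_ac)
    qed (rule expectation_sum_of_bool)
    also have "\<dots> = (\<Sum>j\<in>J - {i}. ?c j * (\<Prod>l<k. 1 / ?D l))"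
      unfolding expectation_sum_of_bool(2) by (intro sum.cong refl) (simp only: stay[OF _ k])
    also have "\<dots> = 5 * spot_var k * ?N / (x i)\<^sup>2"
      by (simp add: spot_var_def prod_dividef sum_distrib_left sum_divide_distrib mult_ac)
    finally show ?thesis .
  qed

  have good: "i \<in> run m x (spot m \<alpha> e (spot_hashes m d s) (spot_signs m d s) J)"
    if s: "s \<in> set_pmf P" and nb: "\<And>k. k \<le> ?ks \<Longrightarrow> \<not> bad k (spot_hashes m d s) (spot_signs m d s)" for s
  proof -
    let ?\<eta> = "spot_hashes m d s" and ?\<tau> = "spot_signs m d s"
    have sgn: "\<bar>?\<tau> k i\<bar> = 1" if "k \<le> ?ks" for k
      using pairwise_indep_unif_in[OF sign[OF that], of i s] im s that by (auto simp: spot_signs_def)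
    have "i \<in> run m x (spot_from ?ks \<alpha> e ?\<eta> ?\<tau> 0 (T ?\<eta> 0))"
      using J im(2) sgn nb by (intro run_spot_from[where J = J and g = "g ?\<eta>"]) (auto simp: T_def g_def bad_def not_le)
    then show ?thesis by (simp add: spot_def T_def)
  qed

  have "measure_pmf.prob P {s. i \<notin> run m x (spot m \<alpha> e (spot_hashes m d s) (spot_signs m d s) J)} =
      measure_pmf.prob P ({s. i \<notin> run m x (spot m \<alpha> e (spot_hashes m d s) (spot_signs m d s) J)} \<inter> set_pmf P)"
    by (simp only: measure_Int_set_pmf)
  also have "\<dots> \<le> measure_pmf.prob P (\<Union>k\<in>{..?ks}. {s. bad k (spot_hashes m d s) (spot_signs m d s)})"
    using good by (intro measure_pmf.finite_measure_mono) auto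
  also have "\<dots> \<le> (\<Sum>k\<le>?ks. measure_pmf.prob P {s. bad k (spot_hashes m d s) (spot_signs m d s)})"
    by (intro measure_pmf.finite_measure_subadditive_finite) auto
  also have "\<dots> \<le> (\<Sum>k\<le>?ks. 5 * ((1025 / \<alpha>)\<^sup>2 * (1 / 16) ^ k) * (\<alpha> ^ 3 / (2 * 2049\<^sup>2)))"
  proof (rule sum_mono)
    fix k assume k: "k \<in> {..?ks}"
    have "5 * spot_var k * ?N / (x i)\<^sup>2 = 5 * spot_var k * (?N / (x i)\<^sup>2)" by simp
    also have "\<dots> \<le> 5 * ((1025 / \<alpha>)\<^sup>2 * (1 / 16) ^ k) * (\<alpha> ^ 3 / (2 * 2049\<^sup>2))"
    proof (rule mult_mono)
      show "?N / (x i)\<^sup>2 \<le> \<alpha> ^ 3 / (2 * 2049\<^sup>2)" using small xi by (simp add: divide_simps mult.commute)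
    qed (use spot_var_bound[of k] \<alpha> in \<open>auto simp: sum_nonneg\<close>)
    finally show "measure_pmf.prob P {s. bad k (spot_hashes m d s) (spot_signs m d s)} \<le>
        5 * ((1025 / \<alpha>)\<^sup>2 * (1 / 16) ^ k) * (\<alpha> ^ 3 / (2 * 2049\<^sup>2))"
      using step[of k] k by simp
  qed
  \<comment> \<open>The cube of \<open>\<alpha>\<close> in the smallness hypothesis leaves one
    factor \<open>\<alpha>\<close> after the division by \<open>\<alpha>^2\<close>. The numerical
    factor is about 5/8, since 2049 is nearly \<open>2 * 1025\<close>, and stays below 1 after
    multiplication by 16/15.\<close>
  also have "\<dots> = 5 * 1025\<^sup>2 / (2 * 2049\<^sup>2) * \<alpha> * (\<Sum>k\<le>?ks. (1 / 16) ^ k)"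
    using \<alpha> unfolding sum_distrib_left
    by (intro sum.cong refl) (simp add: power_divide power2_eq_square power3_eq_cube)
  also have "\<dots> \<le> 5 * 1025\<^sup>2 / (2 * 2049\<^sup>2) * \<alpha> * (16 / 15)"
  proof (rule mult_left_mono)
    have "(\<Sum>k\<le>?ks. (1 / 16 :: real) ^ k) = (1 - (1 / 16) ^ Suc ?ks) / (1 - 1 / 16)"
      by (subst sum_gp_basic[symmetric, of "1/16"]) (simp add: field_simps)
    also have "\<dots> \<le> 16 / 15" by simp
    finally show "(\<Sum>k\<le>?ks. (1 / 16 :: real) ^ k) \<le> 16 / 15" .
  qed (use \<alpha> in auto)
  also have "\<dots> \<le> \<alpha>" using \<alpha> by simp
  finally show ?thesis .
qed

end

section \<open>Failure probability and cost\<close>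

lemma indep_rv_prob_le_const_fst:
  assumes "indep_rv P X (\<lambda>s. (Y s, Z s))"
    and "\<And>a. a \<in> X ` set_pmf P \<Longrightarrow> measure_pmf.prob P {s. Q a (Y s)} \<le> c"
  shows "measure_pmf.prob P {s. Q (X s) (Y s)} \<le> c"
  using indep_rv_prob_le_const[OF assms(1), of "\<lambda>a y. Q a (fst y)"] assms(2) by simp

lemma indep_rv_prob_le_const_snd:
  assumes "indep_rv P X (\<lambda>s. (Y s, Z s))"
    and "\<And>a. a \<in> X ` set_pmf P \<Longrightarrow> measure_pmf.prob P {s. Q a (Z s)} \<le> c"
  shows "measure_pmf.prob P {s. Q (X s) (Z s)} \<le> c"
  using indep_rv_prob_le_const[OF assms(1), of "\<lambda>a y. Q a (snd y)"] assms(2) by simp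

lemma card_large_le:
  fixes x :: "nat \<Rightarrow> real"
  assumes "0 < \<epsilon>" "0 \<le> p" "(\<Sum>i\<in>{1..m}. \<bar>x i\<bar> powr p) \<le> 1"
  shows "card {i \<in> {1..m}. \<epsilon> < \<bar>x i\<bar>} \<le> A_k0 p \<epsilon>"
proof -
  let ?H = "{i \<in> {1..m}. \<epsilon> < \<bar>x i\<bar>}"
  have "real (card ?H) * \<epsilon> powr p = (\<Sum>i\<in>?H. \<epsilon> powr p)" by simp
  also have "\<dots> \<le> (\<Sum>i\<in>?H. \<bar>x i\<bar> powr p)"
    using assms by (intro sum_mono powr_mono2) auto
  also have "\<dots> \<le> (\<Sum>i\<in>{1..m}. \<bar>x i\<bar> powr p)" by (intro sum_mono2) auto
  finally have "real (card ?H) * \<epsilon> powr p \<le> 1" using assms by linarith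
  then have "real (card ?H) \<le> \<epsilon> powr (- p)" using assms by (simp add: powr_minus field_simps)
  then have "int (card ?H) \<le> \<lfloor>\<epsilon> powr (- p)\<rfloor>" by (simp add: le_floor_iff)
  then show ?thesis by (simp add: A_k0_def)
qed

section \<open>Estimates for the parameters\<close>

context
  fixes p \<epsilon> \<delta> :: real
  assumes p: "1 \<le> p" "p \<le> 2" and \<epsilon>: "0 < \<epsilon>" "\<epsilon> < 1" and \<delta>: "0 < \<delta>" "\<delta> < 1"
begin

lemma inv_eps_powr: "1 \<le> \<epsilon> powr (- p)"
  using powr_mono'[of "- p" 0 \<epsilon>] p \<epsilon> by simp

lemma A_k0_bounds: "1 \<le> A_k0 p \<epsilon>" "A_k0 p \<epsilon> \<le> \<epsilon> powr (- p)"
  using inv_eps_powr by (simp_all add: A_k0_def le_nat_iff le_floor_iff)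

lemma A_alpha_bounds: "0 < A_alpha p \<epsilon> \<delta>" "A_alpha p \<epsilon> \<delta> < 1"
  using A_k0_bounds(1) \<delta> by (simp_all add: A_alpha_def divide_simps)

lemma A_gamma_pos: "0 < A_gamma p \<epsilon> \<delta>"
  using A_alpha_bounds by (simp add: A_gamma_def)

text \<open>The value makes a bucket remainder of at most \<open>(\<epsilon> / \<gamma>)^2\<close>
  meet the smallness hypothesis of \<open>prob_spot_failure\<close> for every heavy
  coordinate.\<close>

lemma A_gamma_square: "(A_gamma p \<epsilon> \<delta>)\<^sup>2 = 2 * 2049\<^sup>2 / A_alpha p \<epsilon> \<delta> ^ 3"
proof -
  let ?a = "A_alpha p \<epsilon> \<delta>"
  have "(?a powr (-3/2))\<^sup>2 = ?a powr (- 3)"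
    using A_alpha_bounds(1) by (simp add: powr_power)
  also have "\<dots> = 1 / ?a ^ 3" using A_alpha_bounds(1) by (simp add: powr_minus divide_inverse)
  finally show ?thesis by (simp add: A_gamma_def power_mult_distrib)
qed

text \<open>As \<open>128 = 4 * 32\<close>, the remainder \<open>(\<epsilon> / \<gamma>)^2\<close>
  is at most \<open>(\<epsilon> / 2)^2 / 32\<close>, as the selection with threshold
  \<open>\<epsilon> / 2\<close> requires.\<close>

lemma A_gamma_square_ge: "128 \<le> (A_gamma p \<epsilon> \<delta>)\<^sup>2"
proof -
  have "A_alpha p \<epsilon> \<delta> ^ 3 \<le> 1" using A_alpha_bounds by (intro power_le_one) auto
  then show ?thesis unfolding A_gamma_square using A_alpha_bounds by (simp add: divide_simps)
qed

lemma A_D_ge: "(A_gamma p \<epsilon> \<delta> / \<epsilon>) powr p * A_k0 p \<epsilon> / (\<delta> / 4) \<le> A_D p \<epsilon> \<delta>"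
  by (simp add: A_D_def real_nat_ceiling_ge)

lemma A_D_pos: "0 < A_D p \<epsilon> \<delta>"
proof -
  have "0 < (A_gamma p \<epsilon> \<delta> / \<epsilon>) powr p * A_k0 p \<epsilon> / (\<delta> / 4)"
    using A_gamma_pos A_k0_bounds(1) \<epsilon> \<delta> by simp
  then have "0 < real (A_D p \<epsilon> \<delta>)" using A_D_ge by linarith
  then show ?thesis by simp
qed

text \<open>For \<open>R = 2 * n - 1\<close> the quotient \<open>2 ^ R / 8 ^ n\<close> equals
  \<open>1 / (2 * 2 ^ n)\<close>, so the failure bound amounts to
  \<open>2 * D / \<delta> \<le> 2 ^ n\<close>. The ceiling in the definition of \<open>R\<close>
  achieves this and overshoots by a bounded amount only.\<close>

lemma A_R_odd:
  obtains n where "0 < n" "A_R p \<epsilon> \<delta> = 2 * n - 1" "real (A_D p \<epsilon> \<delta>) * 2 ^ A_R p \<epsilon> \<delta> / 8 ^ n \<le> \<delta> / 4"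
    "real n \<le> log 2 (2 * A_D p \<epsilon> \<delta> / \<delta>) + 3 / 2"
proof -
  define q where "q = 2 * real (A_D p \<epsilon> \<delta>) / \<delta>"
  define c where "c = \<lceil>log 2 q - 1 / 2\<rceil>"
  have q: "1 \<le> q" using A_D_pos \<delta> by (simp add: q_def field_simps)
  then have c0: "0 \<le> c" unfolding c_def using zero_le_log_cancel_iff[of 2 q] by linarith
  have R: "A_R p \<epsilon> \<delta> = nat (2 * c + 1)" by (simp add: A_R_def c_def q_def field_simps)
  define n where "n = nat c + 1"
  have n: "log 2 q + 1 / 2 \<le> n" "n \<le> log 2 q + 3 / 2" using c0 unfolding n_def c_def by linarith+
  have Rn: "A_R p \<epsilon> \<delta> = 2 * n - 1" using c0 by (simp add: R n_def nat_add_distrib nat_mult_distrib)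
  have "q = 2 powr log 2 q" using q by simp
  also have "\<dots> \<le> 2 powr n" using n(1) by (intro powr_mono) auto
  also have "\<dots> = 2 ^ n" by (simp add: powr_realpow)
  finally have qn: "q \<le> 2 ^ n" .
  have "2 * 2 ^ A_R p \<epsilon> \<delta> = (2::real) ^ (2 * n)"
    unfolding Rn n_def by (simp flip: power_Suc)
  also have "\<dots> = 4 ^ n" by (simp add: power_mult)
  finally have two: "2 * 2 ^ A_R p \<epsilon> \<delta> = (4::real) ^ n" .
  have "real (A_D p \<epsilon> \<delta>) * 2 ^ A_R p \<epsilon> \<delta> / 8 ^ n = (\<delta> / 4) * (q * (2 * 2 ^ A_R p \<epsilon> \<delta>) / 8 ^ n)"
    using \<delta> by (simp add: q_def)
  also have "\<dots> = (\<delta> / 4) * (q / 2 ^ n)"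
    unfolding two using power_mult_distrib[of "4 :: real" 2 n] by simp
  also have "\<dots> \<le> (\<delta> / 4) * 1" using qn \<delta> by (intro mult_left_mono) auto
  finally show ?thesis using that[of n] Rn n by (simp add: n_def q_def)
qed

text \<open>Since \<open>2 * sqrt 32 = 2 powr (7/2)\<close>, the number \<open>k\<close> is the
  floor of \<open>y = (\<epsilon> / 2 / sqrt 32) powr (- p)\<close>, the bound on the number of
  buckets with large mass.\<close>

lemma A_k_gt: "(\<epsilon> / 2 / sqrt 32) powr (- p) < A_k p \<epsilon> + 1"
  and A_k_le: "A_k p \<epsilon> \<le> 2 powr (7 * p / 2) * \<epsilon> powr (- p)"
  and A_G_bound: "0 < A_G p \<epsilon>" "(\<epsilon> / 2) powr (- p) / A_G p \<epsilon> \<le> 3 / 32"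
proof -
  define y where "y = 2 powr (7 * p / 2) * \<epsilon> powr (- p)"
  have "sqrt 32 = 2 powr (5 / 2)"
    by (intro real_sqrt_unique) (simp_all add: powr_power)
  moreover have "2 powr (7 / 2) = (2 :: real) powr 1 * 2 powr (5 / 2)" by (simp only: powr_add[symmetric]) simp
  moreover have "(2 :: real) powr (- (7 / 2)) = 1 / 2 powr (7 / 2)" by (simp only: powr_minus_divide)
  ultimately have sqrt32: "sqrt 32 = 2 powr (5 / 2)" "\<epsilon> / 2 / sqrt 32 = \<epsilon> * 2 powr (- (7 / 2))"
    by simp_all
  then have y: "(\<epsilon> / 2 / sqrt 32) powr (- p) = y"
    using \<epsilon> unfolding sqrt32(2) by (simp add: y_def powr_mult powr_powr)
  have "2 powr (7 / 2) * 1 \<le> y" unfolding y_def using inv_eps_powr p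
    by (intro mult_mono powr_mono) auto
  moreover have "(2::real) powr 3 \<le> 2 powr (7 / 2)" by (intro powr_mono) auto
  ultimately have y8: "8 \<le> y" by simp
  have k: "A_k p \<epsilon> = nat \<lfloor>y\<rfloor>" by (simp add: A_k_def y_def)
  show "(\<epsilon> / 2 / sqrt 32) powr (- p) < A_k p \<epsilon> + 1" unfolding y k using y8 by linarith
  show "A_k p \<epsilon> \<le> 2 powr (7 * p / 2) * \<epsilon> powr (- p)" unfolding y_def[symmetric] k using y8 by linarith
  \<comment> \<open>As \<open>y \<ge> 8\<close>, rounding down loses at most half; hence
    \<open>3/32 * G = 3/8 * k\<close> is at least \<open>3/16 * y\<close>.\<close>
  have k2: "y / 2 \<le> A_k p \<epsilon>" unfolding k using y8 by linarith
  show G0: "0 < A_G p \<epsilon>" using k2 y8 by (simp add: A_G_def)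
  have "(\<epsilon> / 2) powr (- p) = 2 powr p * \<epsilon> powr (- p)"
    using \<epsilon> by (simp add: powr_divide powr_minus field_simps)
  \<comment> \<open>Here \<open>p \<ge> 1\<close> enters: \<open>p \<le> 7 * p / 2 - 5 / 2\<close>
    holds exactly then.\<close>
  also have "\<dots> \<le> 2 powr (7 * p / 2 - 5 / 2) * \<epsilon> powr (- p)"
    using p by (intro mult_right_mono powr_mono) auto
  also have "\<dots> = y / sqrt 32" unfolding sqrt32(1) by (simp add: y_def powr_diff)
  finally have num: "(\<epsilon> / 2) powr (- p) \<le> y / sqrt 32" .
  have "16 / 3 \<le> sqrt 32" by (rule real_le_rsqrt) (simp add: power2_eq_square)
  then have "y / sqrt 32 \<le> y / (16 / 3)" using y8 by (intro divide_left_mono) auto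
  also have "\<dots> \<le> 3 / 32 * A_G p \<epsilon>" using k2 by (simp add: A_G_def)
  finally have "(\<epsilon> / 2) powr (- p) \<le> 3 / 32 * A_G p \<epsilon>" using num by linarith
  then show "(\<epsilon> / 2) powr (- p) / A_G p \<epsilon> \<le> 3 / 32" using G0 by (simp add: pos_divide_le_eq)
qed

section \<open>The three ways of missing a heavy coordinate\<close>

context
  fixes m :: nat and P :: "seed pmf" and sel e and x :: "nat \<Rightarrow> real"
  assumes law: "seed_law p \<epsilon> \<delta> m P" and sel: "selection_rule (A_D p \<epsilon> \<delta>) (A_k p \<epsilon>) sel"
    and e: "enumeration_rule m e" and x: "(\<Sum>i\<in>{1..m}. \<bar>x i\<bar> powr p) \<le> 1"
begin

private abbreviation (input) "D \<equiv> A_D p \<epsilon> \<delta>"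
private abbreviation (input) "R \<equiv> A_R p \<epsilon> \<delta>"
private abbreviation (input) "\<rho> \<equiv> \<epsilon> / A_gamma p \<epsilon> \<delta>"
private abbreviation (input) "heavy \<equiv> {i \<in> {1..m}. \<epsilon> < \<bar>x i\<bar>}"

text \<open>Written with collision indicators as factors, so that the expectation over the bucket
  hash is linear in the \<open>p\<close>-th powers.\<close>

definition isolated :: "(nat \<Rightarrow> nat) \<Rightarrow> nat \<Rightarrow> bool" where
  "isolated h i \<longleftrightarrow> (\<Sum>j\<in>{1..m} - {i}. \<bar>x j\<bar> powr p * of_bool (h j = h i)) < \<rho> powr p"

lemma bucket_law: "pairwise_indep_unif P {1..m} {1..D} (\<lambda>i s. bucket_hash s i)"
  using law by (simp add: seed_law_def Let_def)

lemma isolated_imp_small: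
  assumes "isolated h i"
  shows "(\<Sum>j\<in>{j\<in>{1..m} - {i}. h j = h i}. (x j)\<^sup>2) \<le> \<rho>\<^sup>2"
proof (rule ccontr)
  assume "\<not> ?thesis"
  then have "1 \<le> (\<Sum>j\<in>{j\<in>{1..m} - {i}. h j = h i}. (\<bar>x j\<bar> / \<rho>) powr p)"
    using p \<epsilon> A_gamma_pos by (intro sum_powr_ge_one) auto
  also have "\<dots> = (\<Sum>j\<in>{j\<in>{1..m} - {i}. h j = h i}. \<bar>x j\<bar> powr p) / \<rho> powr p"
    using \<epsilon> A_gamma_pos unfolding sum_divide_distrib by (intro sum.cong refl powr_divide)
  also have "(\<Sum>j\<in>{j\<in>{1..m} - {i}. h j = h i}. \<bar>x j\<bar> powr p) =
      (\<Sum>j\<in>{1..m} - {i}. \<bar>x j\<bar> powr p * of_bool (h j = h i))"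
    by (subst sum.inter_filter, simp, rule sum.cong) simp_all
  finally show False using assms \<epsilon> A_gamma_pos by (simp add: isolated_def)
qed

text \<open>Each other coordinate joins the bucket with probability \<open>1 / D\<close>, so the
  expected remainder in \<open>p\<close>-th powers is at most \<open>1 / D\<close>. By the choice of
  \<open>D\<close>, Markov's inequality gives \<open>\<delta> / 4\<close> divided by
  \<open>k_0\<close>, and at most \<open>k_0\<close> coordinates are heavy.\<close>

lemma prob_not_isolated:
  "measure_pmf.prob P {s. \<exists>i\<in>heavy. \<not> isolated (\<lambda>i\<in>{1..m}. bucket_hash s i) i} \<le> \<delta> / 4"
proof -
  have \<rho>: "0 < \<rho>" using \<epsilon> A_gamma_pos by simp
  have one: "measure_pmf.prob P {s. \<not> isolated (\<lambda>i\<in>{1..m}. bucket_hash s i) i} \<le> (\<delta> / 4) / A_k0 p \<epsilon>"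
    if i: "i \<in> heavy" for i
  proof -
    let ?c = "\<lambda>j. \<bar>x j\<bar> powr p / \<rho> powr p"
    let ?f = "\<lambda>s. \<Sum>j\<in>{1..m} - {i}. ?c j * of_bool (bucket_hash s j = bucket_hash s i)"
    have eq: "(\<Sum>j\<in>{1..m} - {i}. \<bar>x j\<bar> powr p * of_bool ((\<lambda>i\<in>{1..m}. bucket_hash s i) j = (\<lambda>i\<in>{1..m}. bucket_hash s i) i))
        = \<rho> powr p * ?f s" for s
      using \<rho> i unfolding sum_distrib_left by (intro sum.cong refl) (auto simp: powr_eq_0_iff)
    have "measure_pmf.prob P {s. \<not> isolated (\<lambda>i\<in>{1..m}. bucket_hash s i) i} \<le> measure_pmf.expectation P ?f"
    proof (rule prob_le_expectation[OF expectation_sum_of_bool(1)])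
      fix s assume "s \<in> {s. \<not> isolated (\<lambda>i\<in>{1..m}. bucket_hash s i) i}"
      then have "\<rho> powr p * 1 \<le> \<rho> powr p * ?f s" by (simp only: isolated_def eq[symmetric] mem_Collect_eq not_less mult_1_right)
      then show "1 \<le> ?f s" using \<rho> by (simp only: mult_le_cancel_left_pos powr_gt_zero)
    qed (auto intro!: sum_nonneg)
    also have "\<dots> = (\<Sum>j\<in>{1..m} - {i}. ?c j * (1 / D))"
      unfolding expectation_sum_of_bool(2)
      using i A_D_pos pairwise_indep_unif_collision[OF bucket_law, of _ i]
      by (intro sum.cong refl) auto
    also have "\<dots> = (\<Sum>j\<in>{1..m} - {i}. \<bar>x j\<bar> powr p) * (1 / \<rho> powr p / D)"
      unfolding sum_distrib_right by (intro sum.cong refl) simp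
    also have "\<dots> \<le> 1 * (1 / \<rho> powr p / D)"
      by (intro mult_right_mono order_trans[OF sum_mono2 x]) auto
    also have "\<dots> \<le> (\<delta> / 4) / A_k0 p \<epsilon>"
    proof -
      have inv: "(A_gamma p \<epsilon> \<delta> / \<epsilon>) powr p = 1 / \<rho> powr p" by (simp add: powr_divide)
      have "1 / u / d \<le> (\<delta> / 4) / k" if "1 / u * k / (\<delta> / 4) \<le> d" "0 < u" "0 < k" "0 < d" for u k d :: real
        using that \<delta> by (simp add: field_simps)
      from this[OF A_D_ge[unfolded inv]] show ?thesis
        using \<epsilon> A_gamma_pos A_D_pos A_k0_bounds(1) by simp
    qed
    finally show ?thesis .
  qed
  have "measure_pmf.prob P {s. \<exists>i\<in>heavy. \<not> isolated (\<lambda>i\<in>{1..m}. bucket_hash s i) i} \<le>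
      measure_pmf.prob P (\<Union>i\<in>heavy. {s. \<not> isolated (\<lambda>i\<in>{1..m}. bucket_hash s i) i})"
    by (intro measure_pmf.finite_measure_mono) auto
  also have "\<dots> \<le> (\<Sum>i\<in>heavy. measure_pmf.prob P {s. \<not> isolated (\<lambda>i\<in>{1..m}. bucket_hash s i) i})"
    by (intro measure_pmf.finite_measure_subadditive_finite) auto
  also have "\<dots> \<le> (\<Sum>i\<in>heavy. (\<delta> / 4) / A_k0 p \<epsilon>)" by (intro sum_mono one)
  also have "\<dots> = (card heavy / A_k0 p \<epsilon>) * (\<delta> / 4)" by simp
  also have "\<dots> \<le> 1 * (\<delta> / 4)"
    using card_large_le[of \<epsilon> p x m] x p \<epsilon> \<delta> A_k0_bounds(1) by (intro mult_right_mono) auto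
  finally show ?thesis by simp
qed

definition recovered :: "seed \<Rightarrow> nat set" where
  "recovered s = run m x (union_alg (sorted_list_of_set
            (run m x (bucket_select m D R (A_G p \<epsilon>) sel (bucket_hash s) (sel_hash s) (sel_sign s))))
          (\<lambda>d. spot m (A_alpha p \<epsilon> \<delta>) e (spot_hash s d) (spot_sign s d) (bucket m (bucket_hash s) d)))"

lemma bucket_par_range:
  assumes "h \<in> (\<lambda>s. \<lambda>i\<in>{1..m}. bucket_hash s i) ` set_pmf P"
  shows "h ` {1..m} \<subseteq> {1..D}"
proof
  fix d assume "d \<in> h ` {1..m}"
  then obtain s i where "s \<in> set_pmf P" "i \<in> {1..m}" "d = bucket_hash s i" using assms by auto
  then show "d \<in> {1..D}" using pairwise_indep_unif_in[OF bucket_law, of i s] A_D_pos by simp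
qed

lemma bucket_stat_restrict:
  assumes "d \<in> {1..D}"
  shows "bucket_stat m x D R G (bucket_hash s) (sel_hash s) (sel_sign s) d =
    bucket_stat m x D R G (\<lambda>i\<in>{1..m}. bucket_hash s i) (sel_hashes D R s) (sel_signs m R s) d"
  unfolding bucket_stat_def using assms
  by (intro arg_cong[of _ _ median] map_cong refl arg_cong[of _ _ abs] if_cong sum.cong)
     (auto simp: sel_hashes_def sel_signs_def)

text \<open>Isolation depends on the bucket hash alone. Freezing this hash leaves either an empty
  event or the situation of \<open>prob_selection_failure\<close> with
  \<open>t = \<epsilon> / 2\<close>.\<close>

lemma prob_bucket_not_selected:
  "measure_pmf.prob P {s. (\<forall>i\<in>heavy. isolated (\<lambda>i\<in>{1..m}. bucket_hash s i) i) \<and>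
     (\<exists>i\<in>heavy. bucket_hash s i \<notin> sel (\<lambda>d\<in>{1..D}. bucket_stat m x D R (A_G p \<epsilon>)
        (bucket_hash s) (sel_hash s) (sel_sign s) d))} \<le> \<delta> / 4" (is "?lhs \<le> _")
proof -
  obtain n where n: "0 < n" "R = 2 * n - 1" "real D * 2 ^ R / 8 ^ n \<le> \<delta> / 4" using A_R_odd by metis
  have ind: "indep_rv P (\<lambda>s. \<lambda>i\<in>{1..m}. bucket_hash s i)
      (\<lambda>s. ((sel_hashes D R s, sel_signs m R s), \<lambda>d\<in>{1..D}. (spot_hashes m d s, spot_signs m d s)))"
    and bs: "bucket_select_law m D R (A_G p \<epsilon>) P"
    using law by (simp_all add: seed_law_def Let_def)
  let ?Q = "\<lambda>h y. (\<forall>i\<in>heavy. isolated h i) \<and> (\<exists>i\<in>heavy. h i \<notin>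
      sel (\<lambda>d\<in>{1..D}. bucket_stat m x D R (A_G p \<epsilon>) h (fst y) (snd y) d))"
  have "?lhs = measure_pmf.prob P {s. ?Q (\<lambda>i\<in>{1..m}. bucket_hash s i) (sel_hashes D R s, sel_signs m R s)}"
    by (intro arg_cong[of _ _ "measure_pmf.prob P"] Collect_cong conj_cong bex_cong refl)
       (simp_all add: bucket_stat_restrict cong: restrict_cong)
  also have "\<dots> \<le> \<delta> / 4"
  proof (rule indep_rv_prob_le_const_fst[OF ind])
    fix h assume h: "h \<in> (\<lambda>s. \<lambda>i\<in>{1..m}. bucket_hash s i) ` set_pmf P"
    show "measure_pmf.prob P {s. ?Q h (sel_hashes D R s, sel_signs m R s)} \<le> \<delta> / 4"
    proof (cases "\<forall>i\<in>heavy. isolated h i")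
      case True
      have "\<rho>\<^sup>2 \<le> (\<epsilon> / 2)\<^sup>2 / 32"
        using A_gamma_square_ge A_gamma_pos \<epsilon> by (simp add: power_divide divide_simps)
      then have "(\<Sum>j\<in>{j\<in>{1..m} - {i}. h j = h i}. (x j)\<^sup>2) \<le> (\<epsilon> / 2)\<^sup>2 / 32" if "i \<in> heavy" for i
        using isolated_imp_small[of h i] True that by force
      then have *: "measure_pmf.prob P {s. \<exists>i\<in>heavy. h i \<notin>
          sel (\<lambda>d\<in>{1..D}. bucket_stat m x D R (A_G p \<epsilon>) h (sel_hashes D R s) (sel_signs m R s) d)} \<le> real D * 2 ^ R / 8 ^ n"
        using \<epsilon> p x n A_k_gt A_G_bound bucket_par_range[OF h]
        by (intro prob_selection_failure[OF bs sel, where t = "\<epsilon> / 2" and p = p]) auto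
      have eq: "{s. ?Q h (sel_hashes D R s, sel_signs m R s)} = {s. \<exists>i\<in>heavy. h i \<notin>
          sel (\<lambda>d\<in>{1..D}. bucket_stat m x D R (A_G p \<epsilon>) h (sel_hashes D R s) (sel_signs m R s) d)}"
        using True by simp
      show ?thesis by (subst eq) (rule order_trans[OF * n(3)])
    next
      case False
      then have eq: "{s. ?Q h (sel_hashes D R s, sel_signs m R s)} = {}" by blast
      show ?thesis using \<delta> unfolding eq by simp
    qed
  qed
  finally show ?thesis .
qed

text \<open>For a frozen bucket hash each heavy coordinate is lost with probability at most
  \<open>\<alpha> = \<delta> / (2 * k_0)\<close>. The union bound over the heavy coordinates works
  for any joint law of the parameters of different buckets.\<close>

lemma prob_spot_misses:
  "measure_pmf.prob P {s. (\<forall>i\<in>heavy. isolated (\<lambda>i\<in>{1..m}. bucket_hash s i) i) \<and>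
     (\<exists>i\<in>heavy. i \<notin> run m x (spot m (A_alpha p \<epsilon> \<delta>) e (spot_hash s (bucket_hash s i))
        (spot_sign s (bucket_hash s i)) (bucket m (bucket_hash s) (bucket_hash s i))))} \<le> \<delta> / 2" (is "?lhs \<le> _")
proof -
  let ?\<alpha> = "A_alpha p \<epsilon> \<delta>"
  let ?bp = "\<lambda>s. \<lambda>i\<in>{1..m}. bucket_hash s i"
  let ?sp = "\<lambda>s. \<lambda>d\<in>{1..D}. (spot_hashes m d s, spot_signs m d s)"
  have ind: "indep_rv P ?bp (\<lambda>s. ((sel_hashes D R s, sel_signs m R s), ?sp s))"
    and spot: "\<And>d. d \<in> {1..D} \<Longrightarrow> spot_law m ?\<alpha> d P"
    using law by (simp_all add: seed_law_def Let_def)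
  let ?Q = "\<lambda>h y. (\<forall>i\<in>heavy. isolated h i) \<and>
      (\<exists>i\<in>heavy. i \<notin> run m x (spot m ?\<alpha> e (fst (y (h i))) (snd (y (h i))) (bucket m h (h i))))"
  have "?lhs = measure_pmf.prob P ({s. (\<forall>i\<in>heavy. isolated (?bp s) i) \<and>
     (\<exists>i\<in>heavy. i \<notin> run m x (spot m ?\<alpha> e (spot_hash s (bucket_hash s i))
        (spot_sign s (bucket_hash s i)) (bucket m (bucket_hash s) (bucket_hash s i))))} \<inter> set_pmf P)"
    by (simp only: measure_Int_set_pmf)
  also have "\<dots> \<le> measure_pmf.prob P {s. ?Q (?bp s) (?sp s)}"
  proof (intro measure_pmf.finite_measure_mono subsetI)
    fix s
    assume "s \<in> {s. (\<forall>i\<in>heavy. isolated (?bp s) i) \<and>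
     (\<exists>i\<in>heavy. i \<notin> run m x (spot m ?\<alpha> e (spot_hash s (bucket_hash s i))
        (spot_sign s (bucket_hash s i)) (bucket m (bucket_hash s) (bucket_hash s i))))} \<inter> set_pmf P"
    then obtain i where s: "s \<in> set_pmf P" "\<forall>i\<in>heavy. isolated (?bp s) i" and i: "i \<in> heavy"
      and ni: "i \<notin> run m x (spot m ?\<alpha> e (spot_hash s (bucket_hash s i))
        (spot_sign s (bucket_hash s i)) (bucket m (bucket_hash s) (bucket_hash s i)))"
      by blast
    have "bucket_hash s i \<in> {1..D}"
      using bucket_par_range[OF imageI[OF s(1)]] i by force
    moreover have "bucket m (bucket_hash s) (bucket_hash s i) = bucket m (?bp s) (?bp s i)"
      using i by (auto simp: bucket_def)
    moreover have "bucket m (?bp s) (?bp s i) \<subseteq> {1..m}" by (auto simp: bucket_def)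
    ultimately have "i \<notin> run m x (spot m ?\<alpha> e (fst (?sp s (?bp s i))) (snd (?sp s (?bp s i))) (bucket m (?bp s) (?bp s i)))"
      using ni i by (simp add: run_spot_restrict)
    then show "s \<in> {s. ?Q (?bp s) (?sp s)}" using s i by blast
  qed simp
  also have "\<dots> \<le> \<delta> / 2"
  proof (rule indep_rv_prob_le_const_snd[OF ind])
    fix h assume h: "h \<in> ?bp ` set_pmf P"
    show "measure_pmf.prob P {s. ?Q h (?sp s)} \<le> \<delta> / 2"
    proof (cases "\<forall>i\<in>heavy. isolated h i")
      case True
      have one: "measure_pmf.prob P {s. i \<notin> run m x (spot m ?\<alpha> e (fst (?sp s (h i))) (snd (?sp s (h i))) (bucket m h (h i)))} \<le> ?\<alpha>"
        if i: "i \<in> heavy" for i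
      proof -
        have hi: "h i \<in> {1..D}" using bucket_par_range[OF h] i by blast
        have B: "bucket m h (h i) - {i} = {j\<in>{1..m} - {i}. h j = h i}" by (auto simp: bucket_def)
        have "(\<Sum>j\<in>bucket m h (h i) - {i}. (x j)\<^sup>2) \<le> \<rho>\<^sup>2"
          unfolding B using isolated_imp_small True i by blast
        also have "\<dots> = \<epsilon>\<^sup>2 * (?\<alpha> ^ 3 / (2 * 2049\<^sup>2))" by (simp add: power_divide A_gamma_square)
        also have "\<dots> \<le> (x i)\<^sup>2 * (?\<alpha> ^ 3 / (2 * 2049\<^sup>2))"
        proof (rule mult_right_mono)
          show "\<epsilon>\<^sup>2 \<le> (x i)\<^sup>2" using i \<epsilon> power_mono[of \<epsilon> "\<bar>x i\<bar>" 2] by simp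
        qed (use A_alpha_bounds in simp)
        finally have "measure_pmf.prob P {s. i \<notin> run m x (spot m ?\<alpha> e (spot_hashes m (h i) s) (spot_signs m (h i) s) (bucket m h (h i)))} \<le> ?\<alpha>"
          using i \<epsilon> by (intro prob_spot_failure[OF A_alpha_bounds spot[OF hi] e]) (auto simp: bucket_def)
        then show ?thesis using hi by simp
      qed
      have "measure_pmf.prob P {s. ?Q h (?sp s)} \<le>
          measure_pmf.prob P (\<Union>i\<in>heavy. {s. i \<notin> run m x (spot m ?\<alpha> e (fst (?sp s (h i))) (snd (?sp s (h i))) (bucket m h (h i)))})"
        by (intro measure_pmf.finite_measure_mono) auto
      also have "\<dots> \<le> (\<Sum>i\<in>heavy. measure_pmf.prob P {s. i \<notin> run m x (spot m ?\<alpha> e (fst (?sp s (h i))) (snd (?sp s (h i))) (bucket m h (h i)))})"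
        by (intro measure_pmf.finite_measure_subadditive_finite) auto
      also have "\<dots> \<le> (\<Sum>i\<in>heavy. ?\<alpha>)" by (intro sum_mono one)
      also have "\<dots> \<le> real (A_k0 p \<epsilon>) * ?\<alpha>"
        using card_large_le[of \<epsilon> p x m] x p \<epsilon> A_alpha_bounds by simp
      also have "\<dots> = \<delta> / 2" using A_k0_bounds(1) by (simp add: A_alpha_def)
      finally show ?thesis .
    next
      case False
      then have eq: "{s. ?Q h (?sp s)} = {}" by blast
      show ?thesis using \<delta> unfolding eq by simp
    qed
  qed
  finally show ?thesis .
qed

lemma prob_not_recovered: "measure_pmf.prob P {s. \<not> heavy \<subseteq> recovered s} \<le> \<delta>"
proof -
  let ?E0 = "{s. \<exists>i\<in>heavy. \<not> isolated (\<lambda>i\<in>{1..m}. bucket_hash s i) i}"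
  let ?E1 = "{s. (\<forall>i\<in>heavy. isolated (\<lambda>i\<in>{1..m}. bucket_hash s i) i) \<and>
     (\<exists>i\<in>heavy. bucket_hash s i \<notin> sel (\<lambda>d\<in>{1..D}. bucket_stat m x D R (A_G p \<epsilon>)
        (bucket_hash s) (sel_hash s) (sel_sign s) d))}"
  let ?E2 = "{s. (\<forall>i\<in>heavy. isolated (\<lambda>i\<in>{1..m}. bucket_hash s i) i) \<and>
     (\<exists>i\<in>heavy. i \<notin> run m x (spot m (A_alpha p \<epsilon> \<delta>) e (spot_hash s (bucket_hash s i))
        (spot_sign s (bucket_hash s i)) (bucket m (bucket_hash s) (bucket_hash s i))))}"
  have fin: "finite (sel Z)" for Z
    using sel finite_subset[of "sel Z" "{1..D}"] by (auto simp: selection_rule_def)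
  have "i \<in> recovered s" if "s \<notin> ?E0" "s \<notin> ?E1" "s \<notin> ?E2" "i \<in> heavy" for s i
    using that fin unfolding recovered_def run_union_alg run_bucket_select
    by (intro UN_I[of "bucket_hash s i"]) auto
  then have "{s. \<not> heavy \<subseteq> recovered s} \<subseteq> ?E0 \<union> ?E1 \<union> ?E2" by blast
  then have "measure_pmf.prob P {s. \<not> heavy \<subseteq> recovered s} \<le> measure_pmf.prob P (?E0 \<union> ?E1 \<union> ?E2)"
    by (intro measure_pmf.finite_measure_mono) auto
  also have "\<dots> \<le> measure_pmf.prob P (?E0 \<union> ?E1) + measure_pmf.prob P ?E2"
    by (intro measure_Un_le) auto
  also have "\<dots> \<le> measure_pmf.prob P ?E0 + measure_pmf.prob P ?E1 + measure_pmf.prob P ?E2"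
    by (intro add_right_mono measure_Un_le) auto
  also have "\<dots> \<le> \<delta> / 4 + \<delta> / 4 + \<delta> / 2"
    by (intro add_mono prob_not_isolated prob_bucket_not_selected prob_spot_misses)
  finally show ?thesis by simp
qed

lemma expected_error_le:
  assumes m: "1 \<le> m"
  shows "expected_error m (map_pmf (det_alg p \<epsilon> \<delta> m sel e) P) x \<le> ennreal (\<epsilon> + \<delta>)"
proof -
  have x1: "\<bar>x i\<bar> \<le> 1" if "i \<in> {1..m}" for i
  proof (rule ccontr)
    assume "\<not> \<bar>x i\<bar> \<le> 1"
    then have "1 < \<bar>x i\<bar> powr p" using p by (intro gr_one_powr) auto
    also have "\<dots> \<le> (\<Sum>i\<in>{1..m}. \<bar>x i\<bar> powr p)" using that by (intro member_le_sum) auto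
    finally show False using x by simp
  qed
  have fin: "finite (recovered s)" for s
  proof -
    have "recovered s \<subseteq> (\<Union>d. bucket m (bucket_hash s) d)"
      unfolding recovered_def run_union_alg spot_def using run_spot_from_subset by fastforce
    also have "\<dots> \<subseteq> {1..m}" by (auto simp: bucket_def)
    finally show ?thesis using finite_subset by blast
  qed
  \<comment> \<open>A coordinate is reproduced exactly or replaced by 0. If all heavy ones are
    recovered, the error is at most \<open>\<epsilon>\<close>; otherwise the indicator covers
    entries of modulus up to 1.\<close>
  have err: "linf_norm m (\<lambda>i. run m x (det_alg p \<epsilon> \<delta> m sel e s) i - x i) \<le>
      \<epsilon> + indicator {s. \<not> heavy \<subseteq> recovered s} s" for s
    unfolding linf_norm_def
  proof (rule Max.boundedI)
    fix y assume "y \<in> (\<lambda>i. \<bar>run m x (det_alg p \<epsilon> \<delta> m sel e s) i - x i\<bar>) ` {1..m}"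
    then obtain i where i: "i \<in> {1..m}" "y = \<bar>run m x (det_alg p \<epsilon> \<delta> m sel e s) i - x i\<bar>" by blast
    then have "y = (if i \<in> recovered s then 0 else \<bar>x i\<bar>)"
      using run_det_alg[OF fin recovered_def, of i] by auto
    then show "y \<le> \<epsilon> + indicator {s. \<not> heavy \<subseteq> recovered s} s"
      using x1[OF i(1)] i(1) \<epsilon> by (auto simp: indicator_def not_less split: if_splits)
  qed (use m in auto)
  have "expected_error m (map_pmf (det_alg p \<epsilon> \<delta> m sel e) P) x
      \<le> (\<integral>\<^sup>+s. ennreal (\<epsilon> + indicator {s. \<not> heavy \<subseteq> recovered s} s) \<partial>P)"
    unfolding expected_error_def nn_integral_map_pmf
    by (intro nn_integral_mono ennreal_leI err)
  also have "\<dots> = (\<integral>\<^sup>+s. ennreal \<epsilon> + indicator {s. \<not> heavy \<subseteq> recovered s} s \<partial>P)"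
    using \<epsilon> by (intro nn_integral_cong) (auto simp: indicator_def ennreal_plus simp del: ennreal_plus[symmetric])
  also have "\<dots> = ennreal \<epsilon> + ennreal (measure_pmf.prob P {s. \<not> heavy \<subseteq> recovered s})"
    by (subst nn_integral_add) (auto simp: measure_pmf.emeasure_eq_measure)
  also have "\<dots> \<le> ennreal \<epsilon> + ennreal \<delta>"
    by (intro add_left_mono ennreal_leI prob_not_recovered)
  finally show ?thesis using \<epsilon> \<delta> by simp
qed

end

end

section \<open>Cost of the algorithm\<close>

lemma num_meas_det_alg:
  assumes sel: "selection_rule (A_D p \<epsilon> \<delta>) (A_k p \<epsilon>) sel" and e: "enumeration_rule m e"
  shows "num_meas m x (det_alg p \<epsilon> \<delta> m sel e s) \<le>
    A_R p \<epsilon> \<delta> * A_G p \<epsilon> + A_k p \<epsilon> * (2 * spot_kstar m + 3)"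
proof -
  define I where "I = run m x (bucket_select m (A_D p \<epsilon> \<delta>) (A_R p \<epsilon> \<delta>) (A_G p \<epsilon>) sel
    (bucket_hash s) (sel_hash s) (sel_sign s))"
  define F where "F d = spot m (A_alpha p \<epsilon> \<delta>) e (spot_hash s d) (spot_sign s d) (bucket m (bucket_hash s) d)" for d
  have I: "finite I" "card I = A_k p \<epsilon>"
    using sel finite_subset unfolding I_def run_bucket_select selection_rule_def by blast+
  have B: "bucket m (bucket_hash s) d \<subseteq> {1..m}" for d by (auto simp: bucket_def)
  \<comment> \<open>Each selected bucket costs at most \<open>2 * spot_kstar m + 2\<close>
    functionals for Spot and one more for observing the index it returns.\<close>
  have F: "num_meas m x (F d) \<le> 2 * spot_kstar m + 2" "card (run m x (F d)) \<le> 1" for d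
    using num_meas_spot_from[of m x "spot_kstar m" _ _ _ _ 0] card_run_spot_from[OF e B]
    unfolding F_def spot_def by simp_all
  have "card (\<Union>d\<in>I. run m x (F d)) \<le> (\<Sum>d\<in>I. card (run m x (F d)))" by (rule card_UN_le[OF I(1)])
  also have "\<dots> \<le> (\<Sum>d\<in>I. 1)" by (intro sum_mono F)
  finally have K: "card (\<Union>d\<in>I. run m x (F d)) \<le> A_k p \<epsilon>" using I by simp
  have "(\<Sum>d\<leftarrow>sorted_list_of_set I. num_meas m x (F d)) = (\<Sum>d\<in>I. num_meas m x (F d))"
    using I(1) by (subst sum_list_distinct_conv_sum_set) auto
  also have "\<dots> \<le> (\<Sum>d\<in>I. 2 * spot_kstar m + 2)" by (intro sum_mono F)
  finally have "(\<Sum>d\<leftarrow>sorted_list_of_set I. num_meas m x (F d)) \<le> A_k p \<epsilon> * (2 * spot_kstar m + 2)"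
    using I by simp
  then show ?thesis
    using K I(1) unfolding det_alg_def num_meas_bind I_def[symmetric] F_def[symmetric]
    by (simp add: num_meas_union_alg algebra_simps)
qed

text \<open>Only the logarithm of \<open>D\<close> enters the cost, so a crude power suffices. With
  \<open>b = 1 / \<epsilon> \<ge> 4\<close> all constants are absorbed into powers of
  \<open>b\<close>: \<open>k_0\<close> is at most \<open>b ^ 2\<close>, \<open>1 / \<alpha>\<close>
  at most \<open>b ^ 4\<close>, \<open>\<gamma>\<close> at most \<open>b ^ 12\<close>, and one power
  accounts for rounding up.\<close>

lemma A_D_le:
  assumes p: "1 \<le> p" "p \<le> 2" and \<epsilon>: "0 < \<epsilon>" "\<epsilon> \<le> 1 / 4"
  shows "A_D p \<epsilon> \<epsilon> \<le> (1 / \<epsilon>) ^ 31"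
proof -
  define b where "b = 1 / \<epsilon>"
  have b: "4 \<le> b" "1 \<le> b" "0 < b" using \<epsilon> by (simp_all add: b_def field_simps)
  have \<epsilon>b: "\<epsilon> = 1 / b" by (simp add: b_def)
  have k0: "1 \<le> A_k0 p \<epsilon>" "A_k0 p \<epsilon> \<le> \<epsilon> powr (- p)" using A_k0_bounds[of p \<epsilon>] p \<epsilon> by auto
  note k0(2)
  also have "\<epsilon> powr (- p) = b powr p" using b by (simp add: \<epsilon>b powr_divide powr_minus)
  also have "b powr p \<le> b powr 2" using p b by (intro powr_mono) auto
  finally have k0b: "real (A_k0 p \<epsilon>) \<le> b ^ 2" using b by simp
  have \<alpha>0: "0 < A_alpha p \<epsilon> \<epsilon>" using A_alpha_bounds[of p \<epsilon> \<epsilon>] p \<epsilon> by auto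
  have \<gamma>0: "0 < A_gamma p \<epsilon> \<epsilon>" using A_gamma_pos[of p \<epsilon> \<epsilon>] p \<epsilon> by auto
  have "1 / A_alpha p \<epsilon> \<epsilon> = 2 * real (A_k0 p \<epsilon>) * b" by (simp add: A_alpha_def b_def)
  also have "\<dots> \<le> b * b ^ 2 * b" using b k0b by (intro mult_mono) auto
  finally have "1 / A_alpha p \<epsilon> \<epsilon> \<le> b powr 4" using b by (simp add: power_def numeral_eq_Suc mult_ac)
  then have "(1 / A_alpha p \<epsilon> \<epsilon>) powr (3/2) \<le> (b powr 4) powr (3/2)"
    using \<alpha>0 by (intro powr_mono2) auto
  also have "\<dots> = b ^ 6" unfolding powr_powr using b by simp
  finally have \<alpha>b: "A_alpha p \<epsilon> \<epsilon> powr (- 3/2) \<le> b ^ 6"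
    using \<alpha>0 by (simp add: powr_divide powr_minus_divide)
  have "sqrt 2 \<le> 3 / 2" by (rule real_le_lsqrt) (auto simp: power2_eq_square)
  then have "2049 * sqrt 2 \<le> 4 ^ 6" by simp
  also have "\<dots> \<le> b ^ 6" using b by (intro power_mono) auto
  finally have "A_gamma p \<epsilon> \<epsilon> \<le> b ^ 6 * b ^ 6"
    unfolding A_gamma_def using \<alpha>b b by (intro mult_mono) auto
  then have "A_gamma p \<epsilon> \<epsilon> * b \<le> b ^ 6 * b ^ 6 * b" using b by (intro mult_right_mono) auto
  moreover have "b ^ 6 * b ^ 6 * b = b ^ 13" by (simp add: eval_nat_numeral)
  moreover have "A_gamma p \<epsilon> \<epsilon> / \<epsilon> = A_gamma p \<epsilon> \<epsilon> * b" by (simp add: b_def)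
  ultimately have "A_gamma p \<epsilon> \<epsilon> / \<epsilon> \<le> b ^ 13" by linarith
  then have "(A_gamma p \<epsilon> \<epsilon> / \<epsilon>) powr p \<le> (b ^ 13) powr p"
    using \<gamma>0 p \<epsilon> by (intro powr_mono2) auto
  also have "\<dots> \<le> (b ^ 13) powr 2" using p b by (intro powr_mono) auto
  also have "\<dots> = b ^ 26" using b by (simp flip: power_mult)
  finally have "(A_gamma p \<epsilon> \<epsilon> / \<epsilon>) powr p * A_k0 p \<epsilon> * (4 * b) \<le> b ^ 26 * b ^ 2 * (b * b)"
    using k0b b by (intro mult_mono) auto
  also have "\<dots> = b ^ 30" by (simp flip: power_add power2_eq_square)
  finally have D: "(A_gamma p \<epsilon> \<epsilon> / \<epsilon>) powr p * A_k0 p \<epsilon> / (\<epsilon> / 4) \<le> b ^ 30"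
    by (simp add: b_def mult_ac)
  moreover have "0 \<le> (A_gamma p \<epsilon> \<epsilon> / \<epsilon>) powr p * A_k0 p \<epsilon> / (\<epsilon> / 4)" using \<epsilon> by simp
  ultimately have "A_D p \<epsilon> \<epsilon> \<le> b ^ 30 + 1" unfolding A_D_def by linarith
  also have "\<dots> \<le> b ^ 30 + b ^ 30" using b by (intro add_left_mono one_le_power) auto
  also have "\<dots> \<le> b * b ^ 30" using b by simp
  also have "\<dots> = b ^ 31" by (simp add: eval_nat_numeral)
  finally show ?thesis by (simp only: b_def)
qed

lemma A_R_le:
  assumes p: "1 \<le> p" "p \<le> 2" and \<epsilon>: "0 < \<epsilon>" "\<epsilon> \<le> 1 / 4"
  shows "A_R p \<epsilon> \<epsilon> \<le> 134 * ln (1 / \<epsilon>)"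
proof -
  have \<epsilon>1: "\<epsilon> < 1" using \<epsilon> by simp
  obtain n where n: "0 < n" "A_R p \<epsilon> \<epsilon> = 2 * n - 1" "real n \<le> log 2 (2 * A_D p \<epsilon> \<epsilon> / \<epsilon>) + 3 / 2"
    using A_R_odd[of p \<epsilon> \<epsilon>] p \<epsilon>(1) \<epsilon>1 by metis
  have D0: "0 < A_D p \<epsilon> \<epsilon>" using A_D_pos[of p \<epsilon> \<epsilon>] p \<epsilon>(1) \<epsilon>1 by simp
  have b: "4 \<le> 1 / \<epsilon>" using \<epsilon> by (simp add: field_simps)
  have "2 * real (A_D p \<epsilon> \<epsilon>) / \<epsilon> = 2 * (A_D p \<epsilon> \<epsilon> * (1 / \<epsilon>))" by simp
  also have "\<dots> \<le> (1 / \<epsilon>) * ((1 / \<epsilon>) ^ 31 * (1 / \<epsilon>))"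
    using A_D_le[OF p \<epsilon>] b \<epsilon> by (intro mult_mono) auto
  also have "\<dots> = (1 / \<epsilon>) ^ 33" by (simp add: power_def numeral_eq_Suc)
  finally have q: "2 * real (A_D p \<epsilon> \<epsilon>) / \<epsilon> \<le> (1 / \<epsilon>) ^ 33" .
  have l2: "1 / 2 \<le> ln (2 :: real)" using ln2_ge_two_thirds by linarith
  have "ln (2 * real (A_D p \<epsilon> \<epsilon>) / \<epsilon>) \<le> ln ((1 / \<epsilon>) ^ 33)" using q D0 \<epsilon> by (subst ln_le_cancel_iff) auto
  also have "\<dots> = 33 * ln (1 / \<epsilon>)" using \<epsilon> by (subst ln_realpow) auto
  finally have lq: "ln (2 * real (A_D p \<epsilon> \<epsilon>) / \<epsilon>) \<le> 33 * ln (1 / \<epsilon>)" .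
  have l4: "0 \<le> ln (1 / \<epsilon>)" using b by (intro ln_ge_zero) auto
  have "log 2 (2 * A_D p \<epsilon> \<epsilon> / \<epsilon>) \<le> 33 * ln (1 / \<epsilon>) / ln 2"
    unfolding log_def using lq by (intro divide_right_mono) auto
  also have "\<dots> \<le> 33 * ln (1 / \<epsilon>) / (1 / 2)" using l2 l4 by (intro divide_left_mono) auto
  finally have "log 2 (2 * A_D p \<epsilon> \<epsilon> / \<epsilon>) \<le> 66 * ln (1 / \<epsilon>)" by simp
  moreover have "1 \<le> ln (1 / \<epsilon>)"
  proof -
    have "ln (2 * 2) \<le> ln (1 / \<epsilon>)" using b \<epsilon> by (subst ln_le_cancel_iff) auto
    then show ?thesis using l2 by (subst (asm) ln_mult) auto
  qed
  \<comment> \<open>With \<open>L = ln (1 / \<epsilon>) \<ge> 1\<close>,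
    \<open>2 * n - 1 \<le> 132 * L + 2 \<le> 134 * L\<close>.\<close>
  ultimately show ?thesis using n by linarith
qed

text \<open>The base change costs the factor 9 because
  \<open>ln (9/8) = - ln (1 - 1/9) \<ge> 1/9\<close>. For \<open>m \<ge> 16\<close> the iterated
  logarithm is nonnegative, so the bound also covers the truncation at 0.\<close>

lemma spot_kstar_le:
  assumes "16 \<le> m"
  shows "spot_kstar m \<le> 9 * ln (ln (real m)) + 1"
proof -
  have l2: "1 / 2 \<le> ln (2 :: real)" using ln2_ge_two_thirds by linarith
  have "ln (2 ^ 4) \<le> ln (real m)" using assms by (subst ln_le_cancel_iff) auto
  then have lm: "2 \<le> ln (real m)" using l2 by (subst (asm) ln_realpow) auto
  then have llm: "0 \<le> ln (ln (real m))" by simp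
  have l98: "1 / 9 \<le> ln (9 / 8 :: real)" using ln_one_minus_pos_upper_bound[of "1/9"] ln_div[of 1 "9/8::real"] by simp
  have "log 2 (real m) / 8 = ln (real m) / (8 * ln 2)" by (simp add: log_def)
  also have "\<dots> \<le> ln (real m) / 1" using l2 lm by (intro divide_left_mono) auto
  finally have "log (9/8) (log 2 (real m) / 8) \<le> log (9/8) (ln (real m))"
    using assms by (subst log_le_cancel_iff) auto
  also have "\<dots> = ln (ln (real m)) / ln (9/8)" by (simp add: log_def)
  also have "\<dots> \<le> ln (ln (real m)) / (1/9)" using l98 llm by (intro divide_left_mono) auto
  finally have "log (9/8) (log 2 (real m) / 8) \<le> 9 * ln (ln (real m))" by simp
  then show ?thesis using llm unfolding spot_kstar_def by (simp, linarith)
qed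

lemma lp_norm_le_one:
  assumes "0 < p" "lp_norm p m x \<le> 1"
  shows "(\<Sum>i\<in>{1..m}. \<bar>x i\<bar> powr p) \<le> 1"
proof (rule ccontr)
  assume "\<not> ?thesis"
  then have "1 < lp_norm p m x" unfolding lp_norm_def using assms(1) by (intro gr_one_powr) auto
  then show False using assms(2) by simp
qed

lemma num_meas_det_alg_le:
  assumes p: "1 \<le> p" "p \<le> 2" and m: "16 \<le> m" and \<epsilon>: "0 < \<epsilon>" "\<epsilon> < 1 / 2"
    and sel: "selection_rule (A_D p (\<epsilon> / 2) (\<epsilon> / 2)) (A_k p (\<epsilon> / 2)) sel" and e: "enumeration_rule m e"
  shows "num_meas m x (det_alg p (\<epsilon> / 2) (\<epsilon> / 2) m sel e s) \<le>
    563200 * (ln (1 / \<epsilon>) + ln (ln (real m))) * \<epsilon> powr (- p)"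
proof -
  let ?\<epsilon> = "\<epsilon> / 2" and ?L = "ln (1 / \<epsilon>) + ln (ln (real m))"
  have l2: "1 / 2 \<le> ln (2 :: real)" using ln2_ge_two_thirds by linarith
  have "ln 2 \<le> ln (1 / \<epsilon>)" using \<epsilon> by (subst ln_le_cancel_iff) (auto simp: field_simps)
  then have l\<epsilon>: "ln 2 \<le> ln (1 / \<epsilon>)" "1 / 2 \<le> ln (1 / \<epsilon>)" using l2 by linarith+
  have "ln (2 ^ 4) \<le> ln (real m)" using m by (subst ln_le_cancel_iff) auto
  then have "1 \<le> ln (real m)" using l2 by (subst (asm) ln_realpow) auto
  then have llm: "0 \<le> ln (ln (real m))" by simp
  have "ln (1 / ?\<epsilon>) = ln (1 / \<epsilon>) + ln 2" using \<epsilon> by (simp add: ln_div ln_mult)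
  then have "A_R p ?\<epsilon> ?\<epsilon> \<le> 134 * (ln (1 / \<epsilon>) + ln 2)" using A_R_le[of p ?\<epsilon>] p \<epsilon> by simp
  also have "\<dots> \<le> 134 * (ln (1 / \<epsilon>) + ln (1 / \<epsilon>))"
    by (intro mult_left_mono add_left_mono l\<epsilon>(1)) simp
  finally have R: "A_R p ?\<epsilon> ?\<epsilon> \<le> 268 * ln (1 / \<epsilon>)" by simp
  have "A_k p ?\<epsilon> \<le> 2 powr (7 * p / 2) * ?\<epsilon> powr (- p)"
    using A_k_le[of p ?\<epsilon>] p \<epsilon> by simp
  also have "\<dots> = 2 powr (7 * p / 2) * 2 powr p * \<epsilon> powr (- p)"
    by (simp add: powr_divide powr_minus field_simps)
  also have "(2 :: real) powr (7 * p / 2) * 2 powr p = 2 powr (7 * p / 2 + p)" by (simp only: powr_add)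
  also have "2 powr (7 * p / 2 + p) * \<epsilon> powr (- p) \<le> 2 powr 9 * \<epsilon> powr (- p)" using p by (intro mult_right_mono powr_mono) auto
  finally have k: "A_k p ?\<epsilon> \<le> 512 * \<epsilon> powr (- p)" by simp
  have "real (num_meas m x (det_alg p ?\<epsilon> ?\<epsilon> m sel e s)) \<le>
      real (A_R p ?\<epsilon> ?\<epsilon> * A_G p ?\<epsilon> + A_k p ?\<epsilon> * (2 * spot_kstar m + 3))"
    using num_meas_det_alg[OF sel e, of x s] by (simp only: of_nat_le_iff)
  also have "\<dots> = A_k p ?\<epsilon> * (4 * real (A_R p ?\<epsilon> ?\<epsilon>) + 2 * real (spot_kstar m) + 3)"
    by (simp add: A_G_def algebra_simps)
  \<comment> \<open>The bracket is at most
    \<open>1072 * ln (1 / \<epsilon>) + 18 * ln (ln m) + 5\<close>, and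
    \<open>ln (1 / \<epsilon>) \<ge> 1/2\<close> absorbs the 5 into
    \<open>1100 * ?L\<close>.\<close>
  also have "\<dots> \<le> (512 * \<epsilon> powr (- p)) * (1100 * ?L)"
    using R spot_kstar_le[OF m] l\<epsilon>(2) llm by (intro mult_mono k) auto
  also have "\<dots> = 563200 * ?L * \<epsilon> powr (- p)" by simp
  finally show ?thesis .
qed

theorem corollary3p2:
  fixes p :: real
  assumes "1 \<le> p" and "p \<le> 2"
  shows "(\<forall>m\<ge>1. \<forall>\<epsilon>. 0 < \<epsilon> \<and> \<epsilon> < 1 \<longrightarrow>
            (\<forall>A\<in>alg_A p (\<epsilon> / 2) (\<epsilon> / 2) m.
               (SUP x\<in>{x. lp_norm p m x \<le> 1}. expected_error m A x) \<le> ennreal \<epsilon>)) \<and>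
         (\<exists>C>0. \<forall>m\<ge>16. \<forall>\<epsilon>. 0 < \<epsilon> \<and> \<epsilon> < 1 / 2 \<longrightarrow>
            (\<forall>A\<in>alg_A p (\<epsilon> / 2) (\<epsilon> / 2) m.
               ereal_of_enat (card_alg m A) \<le>
                 ereal (C * (ln (1 / \<epsilon>) + ln (ln (real m))) * \<epsilon> powr (-p))))"
proof (intro conjI allI impI ballI)
  fix m :: nat and \<epsilon> :: real and A
  assume m: "1 \<le> m" and \<epsilon>: "0 < \<epsilon> \<and> \<epsilon> < 1" and A: "A \<in> alg_A p (\<epsilon> / 2) (\<epsilon> / 2) m"
  obtain P sel e where A: "A = map_pmf (det_alg p (\<epsilon> / 2) (\<epsilon> / 2) m sel e) P"
    and law: "seed_law p (\<epsilon> / 2) (\<epsilon> / 2) m P"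
      "selection_rule (A_D p (\<epsilon> / 2) (\<epsilon> / 2)) (A_k p (\<epsilon> / 2)) sel" "enumeration_rule m e"
    using A unfolding alg_A_def by blast
  show "(SUP x\<in>{x. lp_norm p m x \<le> 1}. expected_error m A x) \<le> ennreal \<epsilon>"
  proof (rule SUP_least)
    fix x assume "x \<in> {x. lp_norm p m x \<le> 1}"
    then have "(\<Sum>i\<in>{1..m}. \<bar>x i\<bar> powr p) \<le> 1" using assms by (intro lp_norm_le_one) auto
    then have "expected_error m A x \<le> ennreal (\<epsilon> / 2 + \<epsilon> / 2)"
      unfolding A using assms \<epsilon> law m by (intro expected_error_le) auto
    then show "expected_error m A x \<le> ennreal \<epsilon>" by simp
  qed
next
  show "\<exists>C>0. \<forall>m\<ge>16. \<forall>\<epsilon>. 0 < \<epsilon> \<and> \<epsilon> < 1 / 2 \<longrightarrow>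
            (\<forall>A\<in>alg_A p (\<epsilon> / 2) (\<epsilon> / 2) m.
               ereal_of_enat (card_alg m A) \<le>
                 ereal (C * (ln (1 / \<epsilon>) + ln (ln (real m))) * \<epsilon> powr (-p)))"
  proof (intro exI[of _ 563200] conjI allI impI ballI)
    fix m :: nat and \<epsilon> :: real and A
    assume m: "16 \<le> m" and \<epsilon>: "0 < \<epsilon> \<and> \<epsilon> < 1 / 2" and A: "A \<in> alg_A p (\<epsilon> / 2) (\<epsilon> / 2) m"
    obtain P sel e where A: "A = map_pmf (det_alg p (\<epsilon> / 2) (\<epsilon> / 2) m sel e) P"
      and rules: "selection_rule (A_D p (\<epsilon> / 2) (\<epsilon> / 2)) (A_k p (\<epsilon> / 2)) sel" "enumeration_rule m e"
      using A unfolding alg_A_def by blast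
    define B where "B = 563200 * (ln (1 / \<epsilon>) + ln (ln (real m))) * \<epsilon> powr (- p)"
    have le: "real (num_meas m x (det_alg p (\<epsilon> / 2) (\<epsilon> / 2) m sel e s)) \<le> B" for x s
      unfolding B_def using num_meas_det_alg_le[OF assms m _ _ rules] \<epsilon> by blast
    \<comment> \<open>The suprema are taken in \<open>enat\<close>, so the real bound is passed to
      its floor first.\<close>
    have "card_alg m A \<le> enat (nat \<lfloor>B\<rfloor>)"
      unfolding card_alg_def A using le by (intro SUP_least) (auto simp: le_nat_floor)
    then have "ereal_of_enat (card_alg m A) \<le> ereal_of_enat (enat (nat \<lfloor>B\<rfloor>))"
      by (simp only: ereal_of_enat_le_iff)
    also have "\<dots> \<le> ereal B"
      using order_trans[OF of_nat_0_le_iff le] by simp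
    finally show "ereal_of_enat (card_alg m A) \<le>
        ereal (563200 * (ln (1 / \<epsilon>) + ln (ln (real m))) * \<epsilon> powr (- p))"
      unfolding B_def .
  qed simp
qed

end
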